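(* In type $A_{n-1}$, the map $(\overline h(j),j)\mapsto X(w_j)=\overline{Bw_jB/B}$, where $w_j\in S_n$ is the longest permutation satisfying $w_j(\overline h(j))=1$ and $w_j(j)=n$, is a bijection from the set of corners of the modified Hessenberg stair shape to the set of irreducible components of $X_H(e_\theta)$.
   Context: Let $G=\mathrm{SL}_n(\mathbb C)$, $n\ge2$, $B$ upper triangular, $T$ diagonal, $W=S_n$ where $w\in S_n$ is represented by the permutation matrix sending $e_i\mapsto e_{w(i)}$; $X(w)=\overline{BwB/B}\subseteq G/B$ is the Schubert variety. A Hessenberg function is a weakly increasing $h:\{1,\dots,n\}\to\{1,\dots,n\}$ with $j\le h(j)$; its Hessenberg subspace is $H=\{(a_{ij})\in\mathfrak{sl}_n: a_{ij}=0\text{ for }i>h(j)\}$. Let $e_\theta=E_{1n}$ and $X_H(e_\theta)=\{gB:\mathrm{Ad}_{g^{-1}}(e_\theta)\in H\}$ (equivalently, the flags $V_\bullet$ with $e_\theta V_j\subseteq V_{h(j)}$ for all $j$). With the convention $h(0):=0$, the modified Hessenberg function is $\overline h(j)=j-1$ if $h(j-1)=j-1$ and $h(j)=j$, and $\overline h(j)=h(j)$ otherwise; set $\overline h(0):=0$. A pair $(i,j)\in\{1,\dots,n\}^2$ is a corner of the modified Hessenberg stair shape if $i=\overline h(j)$ and $\overline h(j-1)<\overline h(j)$ (for a corner one has $\overline h(j)\ne j$). *)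

theory Defs
  imports "Jordan_Normal_Form.Determinant" "HOL-Combinatorics.Permutations"
          "HOL-Analysis.Abstract_Topology"
begin

(* Matrices are n x n complex matrices with 0-based indices; the paper's
   (1-based) entry (i,j) is the entry (i-1,j-1) here. *)

definition SL :: "nat \<Rightarrow> complex mat set" where
  "SL n = {g \<in> carrier_mat n n. det g = 1}"

definition Borel :: "nat \<Rightarrow> complex mat set" where
  "Borel n = {b \<in> SL n. \<forall>i<n. \<forall>j<n. j < i \<longrightarrow> b $$ (i,j) = 0}"

definition ginv :: "nat \<Rightarrow> complex mat \<Rightarrow> complex mat" where
  "ginv n g = (THE gi. gi \<in> carrier_mat n n \<and> gi * g = 1\<^sub>m n)"

definition cosetB :: "nat \<Rightarrow> complex mat \<Rightarrow> complex mat set" where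
  "cosetB n g = {g * b | b. b \<in> Borel n}"

definition flags :: "nat \<Rightarrow> complex mat set set" where
  "flags n = cosetB n ` SL n"

inductive_set poly_fun :: "nat \<Rightarrow> (complex mat \<Rightarrow> complex) set" for n where
  pf_const: "(\<lambda>A. c) \<in> poly_fun n"
| pf_coord: "i < n \<Longrightarrow> j < n \<Longrightarrow> (\<lambda>A. A $$ (i,j)) \<in> poly_fun n"
| pf_add: "f \<in> poly_fun n \<Longrightarrow> g \<in> poly_fun n \<Longrightarrow> (\<lambda>A. f A + g A) \<in> poly_fun n"
| pf_mult: "f \<in> poly_fun n \<Longrightarrow> g \<in> poly_fun n \<Longrightarrow> (\<lambda>A. f A * g A) \<in> poly_fun n"

definition zariski :: "nat \<Rightarrow> complex mat topology" where
  "zariski n = topology (\<lambda>U. U \<subseteq> carrier_mat n n \<and>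
     (\<exists>F \<subseteq> poly_fun n. carrier_mat n n - U = {A \<in> carrier_mat n n. \<forall>f\<in>F. f A = 0}))"

definition SL_top :: "nat \<Rightarrow> complex mat topology" where
  "SL_top n = subtopology (zariski n) (SL n)"

definition flag_top :: "nat \<Rightarrow> complex mat set topology" where
  "flag_top n = topology (\<lambda>U. U \<subseteq> flags n \<and>
     openin (SL_top n) {g \<in> SL n. cosetB n g \<in> U})"

definition irreducible_in :: "'a topology \<Rightarrow> 'a set \<Rightarrow> bool" where
  "irreducible_in T S \<longleftrightarrow> S \<noteq> {} \<and> S \<subseteq> topspace T \<and>
     (\<forall>A B. closedin T A \<longrightarrow> closedin T B \<longrightarrow> S \<subseteq> A \<union> B \<longrightarrow> S \<subseteq> A \<or> S \<subseteq> B)"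

definition irreducible_components :: "'a topology \<Rightarrow> 'a set set" where
  "irreducible_components T = {Z. irreducible_in T Z \<and>
     (\<forall>Z'. irreducible_in T Z' \<longrightarrow> Z \<subseteq> Z' \<longrightarrow> Z' = Z)}"

(* permutation matrix of w (w permutes {1..n}): e_j \<mapsto> e_{w(j)} *)
definition perm_mat :: "nat \<Rightarrow> (nat \<Rightarrow> nat) \<Rightarrow> complex mat" where
  "perm_mat n w = mat n n (\<lambda>(i,j). if i + 1 = w (j + 1) then 1 else 0)"

(* representative of w in N(T) \<subseteq> SL_n: rescale the first column by sign w *)
definition perm_rep :: "nat \<Rightarrow> (nat \<Rightarrow> nat) \<Rightarrow> complex mat" where
  "perm_rep n w = mat n n (\<lambda>(i,j). (if j = 0 then of_int (sign w) else 1) * perm_mat n w $$ (i,j))"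

definition schubert :: "nat \<Rightarrow> (nat \<Rightarrow> nat) \<Rightarrow> complex mat set set" where
  "schubert n w = (flag_top n) closure_of {cosetB n (b * perm_rep n w) | b. b \<in> Borel n}"

definition hessenberg_fun :: "nat \<Rightarrow> (nat \<Rightarrow> nat) \<Rightarrow> bool" where
  "hessenberg_fun n h \<longleftrightarrow> (\<forall>j\<in>{1..n}. j \<le> h j \<and> h j \<le> n) \<and>
     (\<forall>i\<in>{1..n}. \<forall>j\<in>{1..n}. i \<le> j \<longrightarrow> h i \<le> h j)"

(* Hessenberg subspace H \<subseteq> sl_n (1-based condition a_ij = 0 for i > h(j)) *)
definition in_hess_space :: "nat \<Rightarrow> (nat \<Rightarrow> nat) \<Rightarrow> complex mat \<Rightarrow> bool" where
  "in_hess_space n h M \<longleftrightarrow> M \<in> carrier_mat n n \<and> (\<Sum>i<n. M $$ (i,i)) = 0 \<and>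
     (\<forall>i<n. \<forall>j<n. i + 1 > h (j + 1) \<longrightarrow> M $$ (i,j) = 0)"

definition e_theta :: "nat \<Rightarrow> complex mat" where
  "e_theta n = mat n n (\<lambda>(i,j). if i = 0 \<and> j = n - 1 then 1 else 0)"

definition hess_var :: "nat \<Rightarrow> (nat \<Rightarrow> nat) \<Rightarrow> complex mat set set" where
  "hess_var n h = {cosetB n g | g. g \<in> SL n \<and> in_hess_space n h (ginv n g * e_theta n * g)}"

definition h0 :: "(nat \<Rightarrow> nat) \<Rightarrow> nat \<Rightarrow> nat" where
  "h0 h j = (if j = 0 then 0 else h j)"

definition hbar :: "(nat \<Rightarrow> nat) \<Rightarrow> nat \<Rightarrow> nat" where
  "hbar h j = (if j = 0 then 0
     else if h0 h (j - 1) = j - 1 \<and> h j = j then j - 1 else h j)"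

definition corners :: "nat \<Rightarrow> (nat \<Rightarrow> nat) \<Rightarrow> (nat \<times> nat) set" where
  "corners n h = {(i,j). i \<in> {1..n} \<and> j \<in> {1..n} \<and> i = hbar h j \<and> hbar h (j - 1) < hbar h j}"

definition perm_length :: "nat \<Rightarrow> (nat \<Rightarrow> nat) \<Rightarrow> nat" where
  "perm_length n w = card {(a,b). a \<in> {1..n} \<and> b \<in> {1..n} \<and> a < b \<and> w b < w a}"

definition longest_perm :: "nat \<Rightarrow> nat \<Rightarrow> nat \<Rightarrow> (nat \<Rightarrow> nat)" where
  "longest_perm n a b = (THE w. w permutes {1..n} \<and> w a = 1 \<and> w b = n \<and>
     (\<forall>v. v permutes {1..n} \<and> v a = 1 \<and> v b = n \<longrightarrow> perm_length n v \<le> perm_length n w))"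

end

theory Submission
  imports Defs
begin

text \<open>
  Conjugating by g turns \<open>E_1n\<close> into the rank one matrix x y, where x is the first column of the
  inverse of g and y is the last row of g. Being in the Hessenberg space therefore only constrains
  the last nonzero position a of x and the first nonzero position b of y, namely a \<le> h b; moreover
  a \<noteq> b because y x = 0, and this is what the passage from h to the modified function encodes. Hence
  the variety is the union, over the corners (i,j), of the closed pieces a \<le> i, b \<ge> j.

  Each piece is the Schubert variety of the longest w with w i = 1 and w j = n. By the Bruhat
  decomposition it suffices to reach every monomial matrix of the piece from the open cell, and a
  monomial matrix of v degenerates from the cell of v (p q) along \<open>M (1 + t E_qp)\<close> whenever p < q and
  v p < v q. The cell is irreducible because it is the image of the unipotent upper triangular
  matrices, an affine space. Finally the corners form an antichain, so no piece contains another.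
\<close>

section \<open>Irreducible components of a finite union\<close>

text \<open>The hard inclusion, from a piece into the closure of its open cell, is proved among
  matrices rather than flags. There the closure is the common zero set of all polynomials vanishing
  on the double coset; it is stable under B on both sides, so a single monomial matrix of v brings
  the whole double coset of v with it. Degenerations work because a polynomial in t that vanishes
  for all t \<noteq> 0 vanishes at 0 as well. Restriction to a line also gives irreducibility of the
  cell.

  The values 1 and n enter because, for a monomial matrix of w, the vector x is supported at the
  position where w takes the value 1 and y at the position where it takes the value n. Climbing to
  the longest permutation therefore means moving 1 to the right and n to the left, and the delicate
  case is the one where they stand in each other's way; i \<noteq> j is what resolves it. The
  condition on x is closed because on matrices of determinant 1 the inverse is the adjugate.\<close>

lemma irreducible_in_closure_of:
  assumes "irreducible_in T S"
  shows "irreducible_in T (T closure_of S)"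
  unfolding irreducible_in_def
proof (intro conjI allI impI)
  have S: "S \<noteq> {}" "S \<subseteq> topspace T"
    using assms by (auto simp: irreducible_in_def)
  then show "T closure_of S \<noteq> {}"
    using closure_of_subset by blast
  show "T closure_of S \<subseteq> topspace T"
    by (rule closure_of_subset_topspace)
  fix A B
  assume AB: "closedin T A" "closedin T B" and sub: "T closure_of S \<subseteq> A \<union> B"
  have "S \<subseteq> A \<union> B"
    using sub closure_of_subset[OF S(2)] by blast
  then have "S \<subseteq> A \<or> S \<subseteq> B"
    using assms AB by (auto simp: irreducible_in_def)
  then show "T closure_of S \<subseteq> A \<or> T closure_of S \<subseteq> B"
    using AB closure_of_minimal by blast
qed

text \<open>Closed sets of a subspace are traces of closed sets. This passes from the flag variety,
  where Schubert varieties are closures, to the Hessenberg variety, whose components are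
  sought.\<close>

lemma irreducible_in_subtopology:
  assumes "irreducible_in T S" "S \<subseteq> X"
  shows "irreducible_in (subtopology T X) S"
  unfolding irreducible_in_def
proof (intro conjI allI impI)
  show "S \<noteq> {}" "S \<subseteq> topspace (subtopology T X)"
    using assms by (auto simp: irreducible_in_def)
  fix A B
  assume "closedin (subtopology T X) A" "closedin (subtopology T X) B" and sub: "S \<subseteq> A \<union> B"
  then obtain A' B' where "closedin T A'" "A = A' \<inter> X" "closedin T B'" "B = B' \<inter> X"
    by (auto simp: closedin_subtopology)
  then show "S \<subseteq> A \<or> S \<subseteq> B"
    using assms sub unfolding irreducible_in_def by (metis Int_Un_distrib2 le_inf_iff)
qed

lemma irreducible_in_Union:
  assumes "finite I" "irreducible_in T Z" "\<And>i. i \<in> I \<Longrightarrow> closedin T (C i)" "Z \<subseteq> (\<Union>i\<in>I. C i)"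
  shows "\<exists>i\<in>I. Z \<subseteq> C i"
  using assms(1,3,4)
proof (induction I rule: finite_induct)
  case empty
  then show ?case using assms(2) by (auto simp: irreducible_in_def)
next
  case (insert x F)
  have "closedin T (\<Union>i\<in>F. C i)"
    using insert by (intro closedin_Union) auto
  moreover have "closedin T (C x)" "Z \<subseteq> C x \<union> (\<Union>i\<in>F. C i)"
    using insert.prems by auto
  ultimately have "Z \<subseteq> C x \<or> Z \<subseteq> (\<Union>i\<in>F. C i)"
    using assms(2) unfolding irreducible_in_def by blast
  then show ?case
    using insert.IH insert.prems by auto
qed

text \<open>Any irreducible set is trapped in one member of a finite closed cover, so the components
  are the maximal members; the antichain condition makes every member maximal and the indexing
  injective.\<close>

lemma irreducible_components_finite_Union:
  assumes "finite I"
    and closed: "\<And>i. i \<in> I \<Longrightarrow> closedin T (C i)"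
    and irr: "\<And>i. i \<in> I \<Longrightarrow> irreducible_in T (C i)"
    and cover: "topspace T = (\<Union>i\<in>I. C i)"
    and antichain: "\<And>i j. i \<in> I \<Longrightarrow> j \<in> I \<Longrightarrow> C i \<subseteq> C j \<Longrightarrow> i = j"
  shows "bij_betw C I (irreducible_components T)"
proof -
  have ex: "\<exists>i\<in>I. Z \<subseteq> C i" if "irreducible_in T Z" for Z
  proof (rule irreducible_in_Union)
    show "Z \<subseteq> (\<Union>i\<in>I. C i)"
      using that cover by (auto simp: irreducible_in_def)
  qed (use assms(1) closed that in auto)
  have "C ` I = irreducible_components T"
  proof (intro equalityI subsetI)
    fix Z assume "Z \<in> C ` I"
    then obtain i where i: "i \<in> I" "Z = C i" by auto
    have "Z' = C i" if Z': "irreducible_in T Z'" "C i \<subseteq> Z'" for Z'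
    proof -
      obtain j where "j \<in> I" "Z' \<subseteq> C j" using ex[OF Z'(1)] by blast
      then show ?thesis using antichain[of i j] i Z' by auto
    qed
    then show "Z \<in> irreducible_components T"
      using i irr by (auto simp: irreducible_components_def)
  next
    fix Z assume Z: "Z \<in> irreducible_components T"
    then obtain i where i: "i \<in> I" "Z \<subseteq> C i"
      using ex[of Z] by (auto simp: irreducible_components_def)
    then have "C i = Z"
      using Z irr by (auto simp: irreducible_components_def)
    then show "Z \<in> C ` I" using i by auto
  qed
  moreover have "inj_on C I"
    using antichain by (auto simp: inj_on_def)
  ultimately show ?thesis by (simp add: bij_betw_def)
qed

section \<open>The longest permutation with prescribed positions of 1 and n\<close>

text \<open>Explicit shape of the longest permutation: away from positions a and b its values
  decrease from left to right. It replaces the definite description in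
  \<open>longest_perm\<close>.\<close>

definition decreasing_off :: "nat \<Rightarrow> nat \<Rightarrow> nat \<Rightarrow> (nat \<Rightarrow> nat) \<Rightarrow> bool" where
  "decreasing_off n a b w \<longleftrightarrow> w permutes {1..n} \<and> w a = 1 \<and> w b = n \<and>
     (\<forall>p\<in>{1..n} - {a,b}. \<forall>q\<in>{1..n} - {a,b}. p < q \<longrightarrow> w q < w p)"

text \<open>\<open>perm_length\<close> is the cardinality of this set. The set itself is kept
  because inclusions between inversion sets give uniqueness, which lengths alone do not.\<close>

definition inversions :: "nat \<Rightarrow> (nat \<Rightarrow> nat) \<Rightarrow> (nat \<times> nat) set" where
  "inversions n w = {(a,b). a \<in> {1..n} \<and> b \<in> {1..n} \<and> a < b \<and> w b < w a}"

lemma finite_inversions: "finite (inversions n w)"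
  by (rule finite_subset[of _ "{1..n} \<times> {1..n}"]) (auto simp: inversions_def)

lemma permutes_value_card:
  assumes "w permutes {1..n}" "p \<in> {1..n}"
  shows "w p = Suc (card {q \<in> {1..n}. w q < w p})"
proof -
  have "w ` {q \<in> {1..n}. w q < w p} = {1..<w p}"
  proof (intro equalityI subsetI)
    fix y assume "y \<in> w ` {q \<in> {1..n}. w q < w p}"
    then obtain q where "q \<in> {1..n}" "w q < w p" "y = w q" by auto
    then show "y \<in> {1..<w p}"
      using permutes_in_image[OF assms(1), of q] by auto
  next
    fix y assume y: "y \<in> {1..<w p}"
    then have "y \<in> {1..n}"
      using permutes_in_image[OF assms(1), of p] assms(2) by auto
    then obtain q where "q \<in> {1..n}" "y = w q"
      using permutes_image[OF assms(1)] by (metis imageE)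
    then show "y \<in> w ` {q \<in> {1..n}. w q < w p}" using y by auto
  qed
  moreover have "card (w ` {q \<in> {1..n}. w q < w p}) = card {q \<in> {1..n}. w q < w p}"
    using permutes_inj[OF assms(1)] by (intro card_image) (auto simp: inj_on_def)
  moreover have "w p \<ge> 1"
    using permutes_in_image[OF assms(1), of p] assms(2) by auto
  ultimately show ?thesis by simp
qed

text \<open>The inversion set fixes the relative order of any two values, and each value is one more
  than the number of smaller ones.\<close>

lemma permutation_eq_if_inversions_eq:
  assumes v: "v permutes {1..n}" and w: "w permutes {1..n}"
    and eq: "inversions n v = inversions n w"
  shows "v = w"
proof
  fix p
  show "v p = w p"
  proof (cases "p \<in> {1..n}")
    case True
    have less_iff: "u q < u p \<longleftrightarrow> (if q < p then (q,p) \<notin> inversions n u else (p,q) \<in> inversions n u)"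
      if "u permutes {1..n}" "q \<in> {1..n}" for u q
    proof -
      have "u q = u p \<longleftrightarrow> q = p" using permutes_inj[OF that(1)] by (auto simp: inj_on_def)
      then show ?thesis using that True by (cases "q = p") (auto simp: inversions_def)
    qed
    have "{q \<in> {1..n}. v q < v p} = {q \<in> {1..n}. w q < w p}"
      using less_iff[OF v] less_iff[OF w] eq by auto
    then show ?thesis
      using permutes_value_card[OF v True] permutes_value_card[OF w True] by simp
  qed (use v w in \<open>auto simp: permutes_not_in\<close>)
qed

text \<open>An inversion (p,q) of v has p \<noteq> a and q \<noteq> b, since 1 is never the larger
  value and n never the smaller one. Every such pair with p < q is inverted by w: either one of the
  extreme values is in the right place, or both positions lie in the decreasing part.\<close>

lemma inversions_subset_decreasing_off:
  assumes v: "v permutes {1..n}" "v a = 1" "v b = n" and w: "decreasing_off n a b w"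
  shows "inversions n v \<subseteq> inversions n w"
proof
  fix z assume "z \<in> inversions n v"
  then obtain p q where z: "z = (p,q)" "p \<in> {1..n}" "q \<in> {1..n}" "p < q" "v q < v p"
    by (auto simp: inversions_def)
  have range: "1 \<le> v p" "v p \<le> n" "1 \<le> v q" "v q \<le> n"
    using permutes_in_image[OF v(1), of p] permutes_in_image[OF v(1), of q] z by auto
  have w': "w permutes {1..n}" "w a = 1" "w b = n" using w by (auto simp: decreasing_off_def)
  have range': "1 \<le> w p" "w p \<le> n" "1 \<le> w q" "w q \<le> n"
    using permutes_in_image[OF w'(1), of p] permutes_in_image[OF w'(1), of q] z by auto
  have "w p \<noteq> w q" using permutes_inj[OF w'(1)] z by (auto dest: injD)
  moreover have "p \<noteq> a" "q \<noteq> b" using z v range by auto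
  ultimately have "w q < w p"
    using w z w' range' by (cases "q = a \<or> p = b") (auto simp: decreasing_off_def)
  then show "z \<in> inversions n w" using z by (auto simp: inversions_def)
qed

lemma permutes_comp_transpose:
  assumes "v permutes {1..n::nat}" "p \<in> {1..n}" "q \<in> {1..n}"
  shows "v \<circ> Transposition.transpose p q permutes {1..n}"
  using assms by (intro permutes_compose permutes_swap_id) auto

text \<open>A potential that drops when an ascent is swapped, so that it drives inductions along the
  Bruhat order.\<close>

definition displacement :: "nat \<Rightarrow> (nat \<Rightarrow> nat) \<Rightarrow> nat" where
  "displacement n v = (\<Sum>p\<in>{1..n}. p * v p)"

text \<open>The rearrangement inequality for one pair: the sum drops by (q - p) * (v q - v
  p).\<close>

lemma displacement_swap_less:
  assumes "p \<in> {1..n}" "q \<in> {1..n}" "p < q" "v p < v q"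
  shows "displacement n (v \<circ> Transposition.transpose p q) < displacement n v"
proof -
  have split: "displacement n u = p * u p + q * u q + (\<Sum>k\<in>{1..n} - {p,q}. k * u k)" for u
  proof -
    have "displacement n u = (\<Sum>k\<in>{p,q}. k * u k) + (\<Sum>k\<in>{1..n} - {p,q}. k * u k)"
      unfolding displacement_def using assms by (subst sum.subset_diff[of "{p,q}"]) auto
    then show ?thesis using assms by simp
  qed
  have "(\<Sum>k\<in>{1..n} - {p,q}. k * (v \<circ> Transposition.transpose p q) k) = (\<Sum>k\<in>{1..n} - {p,q}. k * v k)"
    by (rule sum.cong) (auto simp: transpose_def)
  moreover have "p * v q + q * v p < p * v p + q * v q"
  proof -
    obtain d e where "q = p + Suc d" "v q = v p + Suc e"
      using assms by (metis less_imp_add_positive gr0_conv_Suc)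
    then show ?thesis by (simp add: algebra_simps)
  qed
  ultimately show ?thesis
    unfolding split[of v] split[of "v \<circ> Transposition.transpose p q"] by simp
qed

lemma decreasing_off_exists:
  assumes ab: "a \<in> {1..n}" "b \<in> {1..n}" "a \<noteq> b"
  shows "\<exists>w. decreasing_off n a b w"
proof -
  define P where "P v \<longleftrightarrow> v permutes {1..n} \<and> v a = 1 \<and> v b = n" for v
  have n: "1 \<in> {1..n}" "n \<in> {1..n}" "n \<noteq> 1" using ab by auto
  \<comment> \<open>Some permutation with the prescribed values is needed before minimising.
    \<open>u\<close> takes the value 1 at a; exchanging the values \<open>u b\<close> and n
    afterwards puts n at b and leaves 1 alone, as both exchanged values differ from 1.\<close>
  define u where "u = Transposition.transpose a (1::nat)"
  define v0 where "v0 = Transposition.transpose (u b) n \<circ> u"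
  have u: "u permutes {1..n}" "u a = 1" "u b \<noteq> 1"
    unfolding u_def using ab n by (auto intro: permutes_swap_id simp: transpose_def)
  have "P v0" unfolding P_def v0_def
    using u n ab permutes_in_image[OF u(1), of b]
    by (auto intro!: permutes_compose permutes_swap_id simp: transpose_def)
  then obtain w where w: "P w" "\<And>v. P v \<Longrightarrow> displacement n w \<le> displacement n v"
    using ex_has_least_nat[of P v0 "displacement n"] by auto
  \<comment> \<open>At a minimum of the displacement no ascent off {a,b} survives: swapping it would
    keep both prescribed values and lower the displacement.\<close>
  have "w q < w p" if pq: "p \<in> {1..n} - {a,b}" "q \<in> {1..n} - {a,b}" "p < q" for p q
  proof (rule ccontr)
    assume "\<not> w q < w p"
    moreover have "w p \<noteq> w q" using w(1) pq by (auto simp: P_def dest: permutes_inj injD)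
    ultimately have less: "w p < w q" by simp
    have "P (w \<circ> Transposition.transpose p q)"
      using w(1) pq permutes_comp_transpose[of w n p q] by (auto simp: P_def transpose_def)
    then show False using w(2) displacement_swap_less[of p n q w] less pq by fastforce
  qed
  then show ?thesis using w(1) unfolding decreasing_off_def P_def by blast
qed

lemma longest_perm_decreasing_off:
  assumes ab: "a \<in> {1..n}" "b \<in> {1..n}" "a \<noteq> b"
  shows "decreasing_off n a b (longest_perm n a b)"
proof -
  obtain w where w: "decreasing_off n a b w" using decreasing_off_exists[OF ab] by auto
  have len: "perm_length n v = card (inversions n v)" for v
    by (simp add: perm_length_def inversions_def)
  have w': "w permutes {1..n}" "w a = 1" "w b = n" using w by (auto simp: decreasing_off_def)
  have max: "perm_length n v \<le> perm_length n w" if "v permutes {1..n}" "v a = 1" "v b = n" for v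
    unfolding len using inversions_subset_decreasing_off[OF that w] finite_inversions
    by (rule card_mono[rotated])
  have "longest_perm n a b = w"
    unfolding longest_perm_def
  proof (rule the_equality)
    fix v
    assume v: "v permutes {1..n} \<and> v a = 1 \<and> v b = n \<and>
      (\<forall>u. u permutes {1..n} \<and> u a = 1 \<and> u b = n \<longrightarrow> perm_length n u \<le> perm_length n v)"
    \<comment> \<open>A competitor of maximal length has its inversions among those of
      \<open>w\<close> and at least as many of them, so the two sets coincide.\<close>
    then have "inversions n v \<subseteq> inversions n w" "card (inversions n w) \<le> card (inversions n v)"
      using inversions_subset_decreasing_off[OF _ _ _ w] w' len by auto
    then have "inversions n v = inversions n w"
      using finite_inversions by (metis card_seteq)
    then show "v = w" using permutation_eq_if_inversions_eq v w' by blast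
  qed (use w' max in auto)
  then show ?thesis using w by simp
qed

lemma decreasing_off_unique:
  assumes "decreasing_off n a b v" "decreasing_off n a b w"
  shows "v = w"
proof (rule permutation_eq_if_inversions_eq)
  show "inversions n v = inversions n w"
    using inversions_subset_decreasing_off assms unfolding decreasing_off_def
    by (metis (no_types, lifting) subset_antisym assms)
qed (use assms in \<open>auto simp: decreasing_off_def\<close>)

text \<open>Downward induction in the Bruhat order inside the set of permutations with 1 placed weakly
  before a and n placed weakly after b; its top element is the one from decreasing_off.\<close>

lemma bruhat_descent_induct :
  assumes ab: "a \<in> {1..n}" "b \<in> {1..n}" "a \<noteq> b"
    and v: "v permutes {1..n}" "v s = 1" "s \<le> a" "v t = n" "b \<le> t" 
    and top: "\<And>w. decreasing_off n a b w \<Longrightarrow> P w"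
    and swap: "\<And>v p q. v permutes {1..n} \<Longrightarrow> p \<in> {1..n} \<Longrightarrow> q \<in> {1..n} \<Longrightarrow> p < q \<Longrightarrow> v p < v q
      \<Longrightarrow> P (v \<circ> Transposition.transpose p q) \<Longrightarrow> P v"
  shows "P v"
  using v
proof (induction "displacement n v" arbitrary: v s t rule: less_induct)
  case less
  note v = less.prems
  have n: "n \<noteq> 1" using ab by auto
  have st: "s \<in> {1..n}" "t \<in> {1..n}" "s \<noteq> t"
    using permutes_in_image[OF v(1), of s] permutes_in_image[OF v(1), of t] v n ab by auto
  have val1: "v p = 1 \<longleftrightarrow> p = s" and valn: "v p = n \<longleftrightarrow> p = t" for p
    using permutes_inj[OF v(1)] v by (metis injD)+
  have bounds: "1 \<le> v p" "v p \<le> n" if "p \<in> {1..n}" for p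
    using permutes_in_image[OF v(1), of p] that by auto
  have step: "P v" if pq: "p \<in> {1..n}" "q \<in> {1..n}" "p < q" "v p < v q"
    and pos: "Transposition.transpose p q s \<le> a" "b \<le> Transposition.transpose p q t" for p q
  proof (rule swap)
    show "P (v \<circ> Transposition.transpose p q)"
    proof (rule less.hyps)
      show "displacement n (v \<circ> Transposition.transpose p q) < displacement n v"
        by (rule displacement_swap_less) (use pq in auto)
      show "v \<circ> Transposition.transpose p q permutes {1..n}"
        by (rule permutes_comp_transpose) (use v pq in auto)
      show "(v \<circ> Transposition.transpose p q) (Transposition.transpose p q s) = 1"
        "(v \<circ> Transposition.transpose p q) (Transposition.transpose p q t) = n"
        using v by (simp_all only: o_apply transpose_involutory)
    qed (use pos in auto)
  qed (use v pq in auto)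
  show ?case
  proof (cases "s = a")
    case False
    then have "s < a" using v by simp
    \<comment> \<open>The value 1 moves right, to a if possible. If n sits at a, the swap would
      throw n back to s, so 1 stops at a - 1 instead. If it is already there, the swap with a is
      harmless: n lands on a - 1, and b \<le> a - 1 because b \<le> t = a and a \<noteq> b.\<close>
    define q where "q = (if a \<noteq> t then a else if s < a - 1 then a - 1 else a)"
    have q: "q \<in> {1..n}" "s < q" using ab \<open>s < a\<close> by (auto simp: q_def)
    show ?thesis
    proof (rule step[of s q])
      show "v s < v q" using val1[of q] bounds[of q] q v by fastforce
      show "Transposition.transpose s q s \<le> a" by (auto simp: q_def)
      show "b \<le> Transposition.transpose s q t"
        using v st ab \<open>s < a\<close> by (auto simp: transpose_def q_def)
    qed (use st q in auto)
  next
    case sa: True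
    show ?thesis
    proof (cases "t = b")
      case False
      then have "b < t" using v by simp
      \<comment> \<open>Now 1 is in place and n goes directly to b; position a is neither b nor t,
        so 1 does not move.\<close>
      show ?thesis
        by (rule step[of b t])
          (use valn[of b] bounds[of b] \<open>b < t\<close> v ab st sa in \<open>auto simp: transpose_def\<close>)
    next
      case tb: True
      show ?thesis
      proof (cases "decreasing_off n a b v")
        case False
        then obtain p q where pq: "p \<in> {1..n} - {a,b}" "q \<in> {1..n} - {a,b}" "p < q" "\<not> v q < v p"
          using v sa tb unfolding decreasing_off_def by blast
        moreover have "v p \<noteq> v q" using permutes_inj[OF v(1)] pq by (auto dest: injD)
        ultimately have "v p < v q" by simp
        then show ?thesis
          by (intro step[of p q]) (use pq sa tb v in \<open>auto simp: transpose_def\<close>)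
      qed (rule top)
    qed
  qed
qed

section \<open>Modified Hessenberg functions\<close>

lemma hbar_le: "j > 0 \<Longrightarrow> hbar h j \<le> h j"
  by (auto simp: hbar_def)

text \<open>The modification lowers the value at \<open>Suc k\<close> to k only when
  \<open>h k = k\<close>, and then the previous value is at most k too.\<close>

lemma hbar_mono:
  assumes "hessenberg_fun n h" "i \<le> j" "j \<le> n"
  shows "hbar h i \<le> hbar h j"
proof -
  have "hbar h k \<le> hbar h (Suc k)" if "Suc k \<le> n" for k
  proof (cases "k = 0")
    case False
    then have "k \<in> {1..n}" "Suc k \<in> {1..n}" using that by auto
    then have "h k \<le> h (Suc k)" "k \<le> h k" "Suc k \<le> h (Suc k)"
      using assms(1) by (auto simp: hessenberg_fun_def)
    then show ?thesis using False by (auto simp: hbar_def h0_def)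
  qed (simp add: hbar_def)
  show ?thesis using assms(2,3)
  proof (induction j rule: dec_induct)
    case (step k)
    then show ?case using \<open>\<And>k. Suc k \<le> n \<Longrightarrow> hbar h k \<le> hbar h (Suc k)\<close>[of k] by simp
  qed simp
qed

text \<open>If the modified value at j is j, then j was not lowered, so h (j - 1) must equal j by
  monotonicity. The modified function is then already j at j - 1, and there is no jump at j.\<close>

lemma corner_off_diagonal:
  assumes "hessenberg_fun n h" "(i,j) \<in> corners n h"
  shows "i \<noteq> j"
proof
  assume "i = j"
  then have j: "j \<in> {1..n}" "hbar h j = j" "hbar h (j - 1) < j"
    using assms(2) by (auto simp: corners_def)
  then have hj: "h j = j" "h0 h (j - 1) \<noteq> j - 1"
    by (auto simp: hbar_def split: if_splits)
  then have "j \<noteq> 1" by (auto simp: h0_def)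
  then have "j - 1 \<in> {1..n}" using j by auto
  then have "j - 1 \<le> h (j - 1)" "h (j - 1) \<le> h j"
    using assms(1) j unfolding hessenberg_fun_def by (meson diff_le_self)+
  then have "h (j - 1) = j" using hj \<open>j \<noteq> 1\<close> j by (auto simp: h0_def split: if_splits)
  then show False using j \<open>j \<noteq> 1\<close> by (auto simp: hbar_def split: if_splits)
qed

text \<open>The corner is the left end of the plateau of \<open>hbar\<close> through b. The
  inequality a \<le> h b survives the modification because a lowered value means
  \<open>h b = b\<close>, and then a \<noteq> b gives a \<le> b - 1.\<close>

lemma corner_dominating:
  assumes h: "hessenberg_fun n h" and b: "b \<in> {1..n}" and a: "a \<ge> 1" "a \<le> h b" "a \<noteq> b"
  shows "\<exists>(i,j)\<in>corners n h. a \<le> i \<and> j \<le> b"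
proof -
  have ab: "a \<le> hbar h b" using a b by (auto simp: hbar_def)
  define j where "j = (LEAST j. hbar h j = hbar h b)"
  have j: "hbar h j = hbar h b" unfolding j_def by (rule LeastI) simp
  have "j \<le> b" unfolding j_def by (rule Least_le) simp
  have "j \<noteq> 0" 
  proof
    assume "j = 0"
    then have "hbar h b = 0" using j by (simp add: hbar_def)
    then show False using ab a by simp
  qed
  have "hbar h (j - 1) \<noteq> hbar h b"
    using not_less_Least[of "j - 1" "\<lambda>j. hbar h j = hbar h b"] \<open>j \<noteq> 0\<close> by (auto simp: j_def)
  moreover have "hbar h (j - 1) \<le> hbar h j"
    by (rule hbar_mono[OF h]) (use b \<open>j \<le> b\<close> in auto)
  ultimately have "hbar h (j - 1) < hbar h j" using j by simp
  moreover have "hbar h j \<le> n"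
    using j hbar_le[of b h] h b by (auto simp: hessenberg_fun_def intro: order_trans)
  ultimately have "(hbar h j, j) \<in> corners n h"
    using \<open>j \<noteq> 0\<close> \<open>j \<le> b\<close> b j ab a by (auto simp: corners_def)
  then show ?thesis using j ab \<open>j \<le> b\<close> by auto
qed

text \<open>Corner heights strictly increase with the column, since the function jumps at each
  corner; a corner further left is therefore strictly lower.\<close>

lemma corners_antichain:
  assumes h: "hessenberg_fun n h" and c: "(i,j) \<in> corners n h" "(i',j') \<in> corners n h"
    and le: "i \<le> i'" "j' \<le> j"
  shows "(i,j) = (i',j')"
proof (cases "j' = j")
  case True
  then show ?thesis using c by (auto simp: corners_def)
next
  case False
  then have "j' \<le> j - 1" using le by simp
  then have "hbar h j' \<le> hbar h (j - 1)"
    by (rule hbar_mono[OF h]) (use c in \<open>auto simp: corners_def\<close>)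
  then show ?thesis using c le by (auto simp: corners_def)
qed

lemma finite_corners: "finite (corners n h)"
  by (rule finite_subset[of _ "{1..n} \<times> {1..n}"]) (auto simp: corners_def)

section \<open>Special linear and Borel groups\<close>

lemma mult_mat_entry:
  assumes "A \<in> carrier_mat n n" "B \<in> carrier_mat n n" "i < n" "j < n"
  shows "(A * B) $$ (i,j) = (\<Sum>k<n. A $$ (i,k) * B $$ (k,j))"
  using assms by (simp add: scalar_prod_def lessThan_atLeast0)

lemma mult_mat_entry_zero:
  assumes "A \<in> carrier_mat n n" "B \<in> carrier_mat n n" "i < n" "j < n"
    and "\<And>k. k < n \<Longrightarrow> A $$ (i,k) * B $$ (k,j) = 0"
  shows "(A * B) $$ (i,j) = 0"
  unfolding mult_mat_entry[OF assms(1-4)] using assms(5) by (intro sum.neutral) auto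

text \<open>Fixing a single dimension here and in the next rules spares the simplifier from guessing
  the inner dimension of a product.\<close>

lemma square_mult_carrier [simp]:
  "A \<in> carrier_mat n n \<Longrightarrow> B \<in> carrier_mat n n \<Longrightarrow> A * B \<in> carrier_mat n n"
  by (rule mult_carrier_mat)

lemma square_mult_assoc:
  fixes A B C :: "'a :: semiring_0 mat"
  assumes "A \<in> carrier_mat n n" "B \<in> carrier_mat n n" "C \<in> carrier_mat n n"
  shows "A * B * C = A * (B * C)"
  using assms by (rule assoc_mult_mat)

lemma square_mult_one_left [simp]:
  fixes A :: "'a :: semiring_1 mat"
  shows "A \<in> carrier_mat n n \<Longrightarrow> 1\<^sub>m n * A = A"
  by (rule left_mult_one_mat)

lemma square_mult_one_right [simp]:
  fixes A :: "'a :: semiring_1 mat"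
  shows "A \<in> carrier_mat n n \<Longrightarrow> A * 1\<^sub>m n = A"
  by (rule right_mult_one_mat)

lemma SL_carrier: "g \<in> SL n \<Longrightarrow> g \<in> carrier_mat n n"
  by (simp add: SL_def)

lemma SL_mult: "g \<in> SL n \<Longrightarrow> h \<in> SL n \<Longrightarrow> g * h \<in> SL n"
  by (auto simp: SL_def det_mult)

text \<open>Determinant 1 makes the adjugate the inverse. This shows that \<open>ginv\<close> is
  well defined and that its entries are polynomials in those of g, which is needed for
  closedness.\<close>

lemma
  assumes "g \<in> SL n"
  shows ginv_eq_adj_mat: "ginv n g = adj_mat g"
    and ginv_left: "ginv n g * g = 1\<^sub>m n" and ginv_right: "g * ginv n g = 1\<^sub>m n"
    and ginv_SL: "ginv n g \<in> SL n"
proof -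
  have g: "g \<in> carrier_mat n n" "det g = 1" using assms by (auto simp: SL_def)
  note adj = adj_mat[OF g(1)]
  have one: "adj_mat g * g = 1\<^sub>m n" "g * adj_mat g = 1\<^sub>m n" using adj g by auto
  show eq: "ginv n g = adj_mat g"
    unfolding ginv_def
  proof (rule the_equality)
    fix k assume k: "k \<in> carrier_mat n n \<and> k * g = 1\<^sub>m n"
    then have "k = k * (g * adj_mat g)" using one right_mult_one_mat[of k n n] by simp
    also have "\<dots> = (k * g) * adj_mat g"
      by (rule square_mult_assoc[of _ n, symmetric]) (use k g adj in auto)
    finally show "k = adj_mat g" using k adj by simp
  qed (use adj one in auto)
  show "ginv n g * g = 1\<^sub>m n" "g * ginv n g = 1\<^sub>m n" using one eq by auto
  have "det (adj_mat g) * det g = 1" using one adj(1) g(1) by (metis det_mult det_one)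
  then show "ginv n g \<in> SL n" using eq adj g by (auto simp: SL_def)
qed

lemma ginv_unique:
  assumes "g \<in> SL n" "k \<in> carrier_mat n n" "k * g = 1\<^sub>m n"
  shows "ginv n g = k"
proof -
  have "k * (g * ginv n g) = (k * g) * ginv n g"
    by (rule square_mult_assoc[of _ n, symmetric])
      (use assms in \<open>auto simp: SL_carrier ginv_SL\<close>)
  then show ?thesis
    using assms right_mult_one_mat[of k n n] SL_carrier[OF ginv_SL[OF assms(1)]]
    by (simp add: ginv_right)
qed

lemma ginv_mult:
  assumes g: "g \<in> SL n" and h: "h \<in> SL n"
  shows "ginv n (g * h) = ginv n h * ginv n g"
proof (rule ginv_unique)
  note [simp] = SL_carrier[OF g] SL_carrier[OF h] SL_carrier[OF ginv_SL[OF g]]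
    SL_carrier[OF ginv_SL[OF h]]
  have "ginv n h * ginv n g * (g * h) = ginv n h * (ginv n g * (g * h))"
    by (rule square_mult_assoc[of _ n]) auto
  also have "ginv n g * (g * h) = (ginv n g * g) * h"
    by (rule square_mult_assoc[of _ n, symmetric]) auto
  finally show "ginv n h * ginv n g * (g * h) = 1\<^sub>m n"
    by (simp add: ginv_left[OF g] ginv_left[OF h])
qed (use assms in \<open>auto simp: SL_mult SL_carrier ginv_SL\<close>)

lemma Borel_SL: "b \<in> Borel n \<Longrightarrow> b \<in> SL n"
  by (simp add: Borel_def)

lemma Borel_carrier: "b \<in> Borel n \<Longrightarrow> b \<in> carrier_mat n n"
  by (simp add: Borel_def SL_def)

lemma Borel_zero: "b \<in> Borel n \<Longrightarrow> i < n \<Longrightarrow> j < i \<Longrightarrow> b $$ (i,j) = 0"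
  by (simp add: Borel_def)

lemma Borel_one: "1\<^sub>m n \<in> Borel n"
  by (auto simp: Borel_def SL_def)

lemma Borel_mult:
  assumes "b \<in> Borel n" "c \<in> Borel n"
  shows "b * c \<in> Borel n"
proof -
  have "(b * c) $$ (i,j) = 0" if "i < n" "j < i" for i j
  proof -
    have "b $$ (i,k) * c $$ (k,j) = 0" if "k < n" for k
      using Borel_zero[OF assms(1) \<open>i < n\<close>, of k] Borel_zero[OF assms(2) that, of j] \<open>j < i\<close>
      by (cases "k < i") auto
    then show ?thesis
      using that
      by (intro mult_mat_entry_zero[OF Borel_carrier[OF assms(1)] Borel_carrier[OF assms(2)]]) auto
  qed
  then show ?thesis
    using SL_mult assms by (auto simp: Borel_def)
qed

lemma Borel_upper_triangular: "b \<in> Borel n \<Longrightarrow> upper_triangular b"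
  by (auto simp: Borel_def SL_def upper_triangular_def)

lemma Borel_diag_nonzero:
  assumes "b \<in> Borel n" "i < n"
  shows "b $$ (i,i) \<noteq> 0"
proof -
  have "prod_list (diag_mat b) = 1"
    using det_upper_triangular[OF Borel_upper_triangular Borel_carrier] assms
    by (auto simp: Borel_def SL_def)
  moreover have "b $$ (i,i) \<in> set (diag_mat b)"
    using assms Borel_carrier[OF assms(1)] by (auto simp: diag_mat_def)
  ultimately show ?thesis by (metis prod_list_zero_iff zero_neq_one)
qed

lemma Borel_ginv:
  assumes b: "b \<in> Borel n"
  shows "ginv n b \<in> Borel n"
proof -
  note c = ginv_right[OF Borel_SL[OF b]] ginv_SL[OF Borel_SL[OF b]]
  have "ginv n b $$ (i,j) = 0" if "i < n" "j < i" for i j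
  proof (rule ccontr)
    assume ne: "ginv n b $$ (i,j) \<noteq> 0"
    \<comment> \<open>Row m holds the lowest nonzero entry of column j of the inverse. In entry
      (m,j) of b times its inverse only the diagonal term of b survives, so this entry is nonzero
      although m > j.\<close>
    define m where "m = Max {k. k < n \<and> ginv n b $$ (k,j) \<noteq> 0}"
    have fin: "finite {k. k < n \<and> ginv n b $$ (k,j) \<noteq> 0}" by auto
    have m: "m < n" "ginv n b $$ (m,j) \<noteq> 0"
      using Max_in[OF fin, folded m_def] ne \<open>i < n\<close> by auto
    have "i \<le> m" unfolding m_def by (rule Max_ge[OF fin]) (use ne that in auto)
    have beyond: "ginv n b $$ (k,j) = 0" if "k < n" "m < k" for k
      using Max_ge[OF fin, of k, folded m_def] that by auto
    have "(b * ginv n b) $$ (m,j) = (\<Sum>k<n. b $$ (m,k) * ginv n b $$ (k,j))"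
      using m that by (intro mult_mat_entry Borel_carrier[OF b] SL_carrier[OF c(2)]) auto
    also have "\<dots> = (\<Sum>k<n. if k = m then b $$ (m,m) * ginv n b $$ (m,j) else 0)"
      using beyond Borel_zero[OF b m(1)] by (intro sum.cong) (auto simp: nat_neq_iff)
    also have "\<dots> = b $$ (m,m) * ginv n b $$ (m,j)" using m by simp
    finally show False
      using m Borel_diag_nonzero[OF b m(1)] c(1) \<open>i \<le> m\<close> that by simp
  qed
  then show ?thesis using c(2) by (auto simp: Borel_def)
qed

lemma unitriangular_Borel:
  assumes u: "u \<in> carrier_mat n n" and diag: "\<And>i. i < n \<Longrightarrow> u $$ (i,i) = 1"
    and zero: "\<And>i j. i < n \<Longrightarrow> j < i \<Longrightarrow> u $$ (i,j) = 0"
  shows "u \<in> Borel n"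
proof -
  have "upper_triangular u" using u zero by (auto simp: upper_triangular_def)
  then have "det u = prod_list (diag_mat u)" using u by (rule det_upper_triangular)
  also have "diag_mat u = map (\<lambda>_. 1) [0..<n]"
    unfolding diag_mat_def using u diag by auto
  also have "prod_list \<dots> = 1" by (induction n) auto
  finally show ?thesis using u zero by (auto simp: Borel_def SL_def)
qed

lemma addrow_mat_Borel:
  assumes "k < l" "l < n"
  shows "addrow_mat n a k l \<in> Borel n"
  using assms by (intro unitriangular_Borel) auto

lemma double_coset_inverse:
  assumes b: "b \<in> Borel n" "c \<in> Borel n" and g: "g \<in> carrier_mat n n"
  shows "g = ginv n b * (b * g * c) * ginv n c"
proof -
  note [simp] = g Borel_carrier[OF b(1)] Borel_carrier[OF b(2)]
    Borel_carrier[OF Borel_ginv[OF b(1)]] Borel_carrier[OF Borel_ginv[OF b(2)]]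
  have "ginv n b * (b * g * c) = ginv n b * (b * (g * c))"
    by (subst square_mult_assoc[of b n]) auto
  also have "\<dots> = ginv n b * b * (g * c)"
    by (rule square_mult_assoc[of _ n, symmetric]) auto
  also have "\<dots> = g * c" by (simp add: ginv_left[OF Borel_SL[OF b(1)]])
  finally have "ginv n b * (b * g * c) * ginv n c = g * c * ginv n c" by simp
  also have "\<dots> = g * (c * ginv n c)"
    by (rule square_mult_assoc[of _ n]) auto
  finally show ?thesis by (simp add: ginv_right[OF Borel_SL[OF b(2)]])
qed

lemma self_in_cosetB:
  assumes "g \<in> carrier_mat n n"
  shows "g \<in> cosetB n g"
  using Borel_one[of n] assms unfolding cosetB_def by (force intro: exI[of _ "1\<^sub>m n"])

lemma cosetB_mult:
  assumes g: "g \<in> carrier_mat n n" and b: "b \<in> Borel n"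
  shows "cosetB n (g * b) = cosetB n g"
proof -
  note cb = Borel_carrier
  have 1: "cosetB n (k * c) \<subseteq> cosetB n k" if k: "k \<in> carrier_mat n n" and c: "c \<in> Borel n" for k c
  proof
    fix x assume "x \<in> cosetB n (k * c)"
    then obtain d where d: "d \<in> Borel n" "x = k * c * d" by (auto simp: cosetB_def)
    then have "x = k * (c * d)" using k cb[OF c] cb[OF d(1)] by simp
    then show "x \<in> cosetB n k" using Borel_mult[OF c d(1)] by (auto simp: cosetB_def)
  qed
  have "g * b * ginv n b = g * (b * ginv n b)"
    by (rule square_mult_assoc[of _ n]) (use g cb[OF b] cb[OF Borel_ginv[OF b]] in auto)
  then have "g * b * ginv n b = g"
    using g by (simp add: ginv_right[OF Borel_SL[OF b]])
  then have "cosetB n g \<subseteq> cosetB n (g * b)"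
    using 1[of "g * b" "ginv n b"] g cb[OF b] Borel_ginv[OF b] by auto
  then show ?thesis using 1[OF g b] by auto
qed

lemma cosetB_eqD:
  assumes "cosetB n g = cosetB n k" "k \<in> carrier_mat n n"
  shows "\<exists>b\<in>Borel n. k = g * b"
  using self_in_cosetB[OF assms(2)] assms(1) unfolding cosetB_def by auto

section \<open>Monomial matrices and the Bruhat decomposition\<close>

text \<open>The coset of the diagonal torus through the permutation matrix of v, given by its zero
  pattern. Scalars are left free because elimination and degeneration produce arbitrary ones. Rows
  and columns count from 0, while v acts on 1 to n.\<close>

definition monomial_mats :: "nat \<Rightarrow> (nat \<Rightarrow> nat) \<Rightarrow> complex mat set" where
  "monomial_mats n v = {M \<in> SL n. \<forall>i<n. \<forall>j<n. Suc i \<noteq> v (Suc j) \<longrightarrow> M $$ (i,j) = 0}"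

lemma monomial_zero:
  "M \<in> monomial_mats n v \<Longrightarrow> i < n \<Longrightarrow> j < n \<Longrightarrow> Suc i \<noteq> v (Suc j) \<Longrightarrow> M $$ (i,j) = 0"
  by (simp add: monomial_mats_def)

lemma monomial_SL: "M \<in> monomial_mats n v \<Longrightarrow> M \<in> SL n"
  by (simp add: monomial_mats_def)

lemma permutes_bounds:
  assumes "v permutes {1..n}" "j < n"
  shows "v (Suc j) - 1 < n" "Suc (v (Suc j) - 1) = v (Suc j)"
  using permutes_in_image[OF assms(1), of "Suc j"] assms(2) by auto

lemma permutes_Suc_inj:
  assumes "v permutes {1..n}"
  shows "v (Suc i) = v (Suc j) \<longleftrightarrow> i = j"
  using permutes_inj[OF assms] by (auto dest: injD)

lemma monomial_nonzero:
  assumes M: "M \<in> monomial_mats n v" and v: "v permutes {1..n}" and j: "j < n"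
  shows "M $$ (v (Suc j) - 1, j) \<noteq> 0"
proof
  assume z: "M $$ (v (Suc j) - 1, j) = 0"
  have "M $$ (k,j) = 0" if "k < n" for k
    using monomial_zero[OF M that j] z by (cases "Suc k = v (Suc j)") (auto dest: sym)
  moreover have "(ginv n M * M) $$ (j,j) = (\<Sum>k<n. ginv n M $$ (j,k) * M $$ (k,j))"
    using j by (intro mult_mat_entry SL_carrier monomial_SL[OF M] ginv_SL) auto
  ultimately show False
    using j by (simp add: ginv_left[OF monomial_SL[OF M]])
qed

lemma det_perm_mat:
  assumes "w permutes {1..n}"
  shows "det (perm_mat n w) = of_int (sign w)"
  using assms finite_atLeastAtMost
proof (induction rule: permutes_induct)
  case id
  have "perm_mat n id = 1\<^sub>m n" by (rule eq_matI) (auto simp: perm_mat_def)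
  then show ?case by (simp only: det_one sign_id of_int_1)
next
  case (swap a b p)
  have ab: "a - 1 < n" "b - 1 < n" "a - 1 \<noteq> b - 1" using swap by auto
  \<comment> \<open>Composition on the left exchanges values, hence rows of the matrix.\<close>
  have "perm_mat n (Transposition.transpose a b \<circ> p) = swaprows (a - 1) (b - 1) (perm_mat n p)"
    by (rule eq_matI) (use swap ab in \<open>auto simp: perm_mat_def transpose_def\<close>)
  then have "det (perm_mat n (Transposition.transpose a b \<circ> p)) = - det (perm_mat n p)"
    using det_swaprows[OF ab, of "perm_mat n p"] by (simp add: perm_mat_def)
  moreover have "sign (Transposition.transpose a b \<circ> p) = - sign p"
    using swap by (subst sign_compose)
      (auto simp: sign_swap_id permutation_swap_id intro: permutes_imp_permutation)
  ultimately show ?case using swap.IH by (simp only: of_int_minus)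
qed

lemma perm_rep_monomial:
  assumes w: "w permutes {1..n}" and n: "n > 0"
  shows "perm_rep n w \<in> monomial_mats n w"
proof -
  have c: "perm_mat n w \<in> carrier_mat n n" by (simp add: perm_mat_def)
  \<comment> \<open>Rescaling the first column is right multiplication by a diagonal matrix of
    determinant \<open>sign w\<close>, so the total determinant is the square of the sign.\<close>
  have "perm_rep n w = perm_mat n w * multrow_mat n 0 (of_int (sign w))"
  proof (rule eq_matI)
    fix i j assume "i < dim_row (perm_mat n w * multrow_mat n 0 (of_int (sign w)))"
      "j < dim_col (perm_mat n w * multrow_mat n 0 (of_int (sign w)))"
    then have ij: "i < n" "j < n" by (auto simp: perm_mat_def)
    have "(perm_mat n w * multrow_mat n 0 (of_int (sign w))) $$ (i,j) =
        (\<Sum>k<n. perm_mat n w $$ (i,k) * multrow_mat n 0 (of_int (sign w)) $$ (k,j))"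
      using c ij by (intro mult_mat_entry) auto
    also have "\<dots> = (\<Sum>k<n. if k = j then perm_mat n w $$ (i,j) * (if j = 0 then of_int (sign w) else 1) else 0)"
      using ij by (intro sum.cong) auto
    also have "\<dots> = perm_rep n w $$ (i,j)" using ij by (simp add: perm_rep_def)
    finally show "perm_rep n w $$ (i,j) = (perm_mat n w * multrow_mat n 0 (of_int (sign w))) $$ (i,j)"
      by simp
  qed (auto simp: perm_rep_def perm_mat_def)
  then have "det (perm_rep n w) = of_int (sign w) * of_int (sign w)"
    using det_mult[OF c, of "multrow_mat n 0 (of_int (sign w))"] det_perm_mat[OF w]
      det_multrow_mat[OF n] by simp
  then have "det (perm_rep n w) = 1" by (metis of_int_1 of_int_mult sign_idempotent)
  then show ?thesis
    by (auto simp: monomial_mats_def SL_def perm_rep_def perm_mat_def)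
qed

text \<open>The quotient is the diagonal matrix of ratios of corresponding entries; its determinant
  is 1 because M and N both have determinant 1.\<close>

lemma monomial_mats_torus:
  assumes M: "M \<in> monomial_mats n v" and N: "N \<in> monomial_mats n v" and v: "v permutes {1..n}"
  shows "\<exists>d\<in>Borel n. M = N * d"
proof -
  define c where "c j = M $$ (v (Suc j) - 1, j) / N $$ (v (Suc j) - 1, j)" for j
  define d where "d = mat n n (\<lambda>(i,j). if i = j then c j else 0)"
  have carr: "M \<in> carrier_mat n n" "N \<in> carrier_mat n n" "d \<in> carrier_mat n n"
    using M N by (auto simp: SL_carrier monomial_SL d_def)
  have eq: "M = N * d"
  proof (rule eq_matI)
    fix i j assume "i < dim_row (N * d)" "j < dim_col (N * d)"
    then have ij: "i < n" "j < n" using carr by auto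
    have "(N * d) $$ (i,j) = (\<Sum>k<n. N $$ (i,k) * d $$ (k,j))"
      using carr ij by (intro mult_mat_entry)
    also have "\<dots> = (\<Sum>k<n. if k = j then N $$ (i,j) * c j else 0)"
      using ij by (intro sum.cong) (auto simp: d_def)
    also have "\<dots> = N $$ (i,j) * c j" using ij by simp
    also have "\<dots> = M $$ (i,j)"
    proof (cases "Suc i = v (Suc j)")
      case True
      then have "v (Suc j) - 1 = i" by simp
      then show ?thesis using monomial_nonzero[OF N v ij(2)] by (simp add: c_def)
    qed (use monomial_zero[OF M ij] monomial_zero[OF N ij] in auto)
    finally show "M $$ (i,j) = (N * d) $$ (i,j)" by simp
  qed (use carr in auto)
  then have "det d = 1"
    using det_mult[OF carr(2,3)] M N by (auto simp: monomial_mats_def SL_def)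
  then have "d \<in> Borel n" using carr by (auto simp: Borel_def SL_def d_def)
  then show ?thesis using eq by blast
qed

text \<open>Gaussian elimination with upper triangular factors only: rows may be added to higher
  rows and columns to later columns. The invariant says that each of the first k columns is reduced
  to a pivot that is also alone in its row.\<close>

lemma bruhat_elimination_step:
  assumes M: "M \<in> SL n" and k: "k < n"
    and inj: "inj_on \<sigma> {..<k}" "\<sigma> ` {..<k} \<subseteq> {..<n}"
    and cols: "\<And>j i. j < k \<Longrightarrow> i < n \<Longrightarrow> i \<noteq> \<sigma> j \<Longrightarrow> M $$ (i,j) = 0"
    and rows: "\<And>j l. j < k \<Longrightarrow> l < n \<Longrightarrow> l \<noteq> j \<Longrightarrow> M $$ (\<sigma> j,l) = 0"
  shows "\<exists>b\<in>Borel n. \<exists>c\<in>Borel n. \<exists>\<tau>. inj_on \<tau> {..<Suc k} \<and> \<tau> ` {..<Suc k} \<subseteq> {..<n} \<and>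
    (\<forall>j<Suc k. \<forall>i<n. i \<noteq> \<tau> j \<longrightarrow> (b * M * c) $$ (i,j) = 0) \<and>
    (\<forall>j<Suc k. \<forall>l<n. l \<noteq> j \<longrightarrow> (b * M * c) $$ (\<tau> j,l) = 0)"
proof -
  have cM: "M \<in> carrier_mat n n" using M by (rule SL_carrier)
  have "\<exists>i<n. M $$ (i,k) \<noteq> 0"
  proof (rule ccontr)
    assume "\<not> ?thesis"
    moreover have "(ginv n M * M) $$ (k,k) = (\<Sum>i<n. ginv n M $$ (k,i) * M $$ (i,k))"
      using k cM by (intro mult_mat_entry SL_carrier[OF ginv_SL[OF M]])
    ultimately show False using k by (simp add: ginv_left[OF M])
  qed
  then have ne: "{i. i < n \<and> M $$ (i,k) \<noteq> 0} \<noteq> {}" by auto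
  have fin: "finite {i. i < n \<and> M $$ (i,k) \<noteq> 0}" by auto
  \<comment> \<open>The pivot is the lowest nonzero entry of column k, so everything left to clear
    in the column lies above it. In row r the entries left of the pivot already vanish by the
    invariant.\<close>
  define r where "r = Max {i. i < n \<and> M $$ (i,k) \<noteq> 0}"
  have r: "r < n" "M $$ (r,k) \<noteq> 0" using Max_in[OF fin ne] unfolding r_def by auto
  have below: "M $$ (i,k) = 0" if "i < n" "r < i" for i
    using Max_ge[OF fin, of i, folded r_def] that by auto
  have r\<sigma>: "\<sigma> j \<noteq> r" if "j < k" for j using rows[OF that, of k] r k that by auto
  have \<sigma>n: "\<sigma> j < n" if "j < k" for j using inj that by auto
  \<comment> \<open>Multiplication by \<open>b\<close> clears column k above the pivot, and
    multiplication by \<open>c\<close> clears row r to the right of it.\<close>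
  define b where "b = mat n n (\<lambda>(i,j). if i = j then 1 else if j = r \<and> i < r then - M $$ (i,k) / M $$ (r,k) else 0)"
  define c where "c = mat n n (\<lambda>(i,j). if i = j then 1 else if i = k \<and> k < j then - M $$ (r,j) / M $$ (r,k) else 0)"
  have b: "b \<in> Borel n" and c: "c \<in> Borel n"
    by (rule unitriangular_Borel; use r k in \<open>auto simp: b_def c_def\<close>)+
  have cb: "b \<in> carrier_mat n n" "c \<in> carrier_mat n n" "b * M \<in> carrier_mat n n"
    using b c cM by (auto intro: Borel_carrier mult_carrier_mat)
  have bM: "(b * M) $$ (i,j) = M $$ (i,j) + (if i < r then - M $$ (i,k) / M $$ (r,k) * M $$ (r,j) else 0)"
    if "i < n" "j < n" for i j
  proof -
    have "(b * M) $$ (i,j) = (\<Sum>l<n. b $$ (i,l) * M $$ (l,j))"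
      using that cb cM by (intro mult_mat_entry)
    also have "\<dots> = (\<Sum>l<n. (if l = i then M $$ (i,j) else 0) +
        (if l = r then (if i < r then - M $$ (i,k) / M $$ (r,k) * M $$ (r,j) else 0) else 0))"
      using that by (intro sum.cong) (auto simp: b_def)
    finally show ?thesis using that r by (simp add: sum.distrib)
  qed
  have bMc: "(b * M * c) $$ (i,j) = (b * M) $$ (i,j) +
      (if k < j then (b * M) $$ (i,k) * (- M $$ (r,j) / M $$ (r,k)) else 0)"
    if "i < n" "j < n" for i j
  proof -
    have "(b * M * c) $$ (i,j) = (\<Sum>l<n. (b * M) $$ (i,l) * c $$ (l,j))"
      using that cb by (intro mult_mat_entry)
    also have "\<dots> = (\<Sum>l<n. (if l = j then (b * M) $$ (i,j) else 0) +
        (if l = k then (if k < j then (b * M) $$ (i,k) * (- M $$ (r,j) / M $$ (r,k)) else 0) else 0))"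
      using that by (intro sum.cong) (auto simp: c_def)
    finally show ?thesis using that k by (simp add: sum.distrib)
  qed
  have col_k: "(b * M) $$ (i,k) = 0" if "i < n" "i \<noteq> r" for i
    using that bM[of i k] k r below[of i] by (cases "i < r") auto
  have row_r: "(b * M) $$ (r,j) = M $$ (r,j)" if "j < n" for j
    using bM[of r j] that r by simp
  define \<tau> where "\<tau> = \<sigma>(k := r)"
  have "inj_on \<tau> {..<Suc k}"
    using inj(1) r\<sigma> unfolding inj_on_def \<tau>_def by (metis fun_upd_apply lessThan_iff less_SucE)
  moreover have "\<tau> ` {..<Suc k} \<subseteq> {..<n}"
    using \<sigma>n r by (auto simp: \<tau>_def less_Suc_eq)
  moreover have "(b * M * c) $$ (i,j) = 0" if "j < Suc k" "i < n" "i \<noteq> \<tau> j" for i j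
  proof (cases "j = k")
    case True
    then show ?thesis using that bMc[of i k] col_k[of i] k by (simp add: \<tau>_def)
  next
    case False
    then have j: "j < k" "j < n" "i \<noteq> \<sigma> j" using that k by (auto simp: \<tau>_def)
    moreover have "M $$ (r,j) = 0" using cols[of j r] r j r\<sigma>[of j] by auto
    ultimately show ?thesis using bMc[of i j] bM[of i j] cols[of j i] that by simp
  qed
  moreover have "(b * M * c) $$ (\<tau> j,l) = 0" if "j < Suc k" "l < n" "l \<noteq> j" for j l
  proof (cases "j = k")
    case True
    show ?thesis
    proof (cases "l < k")
      case lk: True
      then have "M $$ (r,l) = 0" using cols[of l r] r r\<sigma>[of l] by auto
      then show ?thesis using True that bMc[of r l] row_r[of l] lk r by (simp add: \<tau>_def)
    next
      case False
      then show ?thesis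
        using True that bMc[of r l] row_r[of l] row_r[of k] r k by (simp add: \<tau>_def)
    qed
  next
    case False
    then have j: "j < k" using that by simp
    have "M $$ (\<sigma> j,k) = 0" "M $$ (\<sigma> j,l) = 0"
      using rows[of j k] rows[of j l] j k that by auto
    then show ?thesis
      using j that bMc[of "\<sigma> j" l] bM[of "\<sigma> j" l] col_k[of "\<sigma> j"] \<sigma>n[of j] r\<sigma>[of j]
      by (simp add: \<tau>_def)
  qed
  ultimately show ?thesis using b c by blast
qed

lemma bruhat_elimination:
  assumes g: "g \<in> SL n" and "k \<le> n"
  shows "\<exists>b\<in>Borel n. \<exists>c\<in>Borel n. \<exists>\<sigma>. inj_on \<sigma> {..<k} \<and> \<sigma> ` {..<k} \<subseteq> {..<n} \<and>
    (\<forall>j<k. \<forall>i<n. i \<noteq> \<sigma> j \<longrightarrow> (b * g * c) $$ (i,j) = 0) \<and>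
    (\<forall>j<k. \<forall>l<n. l \<noteq> j \<longrightarrow> (b * g * c) $$ (\<sigma> j,l) = 0)"
  using assms(2)
proof (induction k)
  case 0
  show ?case using Borel_one[of n] by (auto intro!: bexI[of _ "1\<^sub>m n"])
next
  case (Suc k)
  then obtain b c \<sigma> where bc: "b \<in> Borel n" "c \<in> Borel n"
    and \<sigma>: "inj_on \<sigma> {..<k}" "\<sigma> ` {..<k} \<subseteq> {..<n}"
      "\<forall>j<k. \<forall>i<n. i \<noteq> \<sigma> j \<longrightarrow> (b * g * c) $$ (i,j) = 0"
      "\<forall>j<k. \<forall>l<n. l \<noteq> j \<longrightarrow> (b * g * c) $$ (\<sigma> j,l) = 0"
    by (metis Suc_leD)
  have "b * g * c \<in> SL n" using g bc by (auto intro!: SL_mult intro: Borel_SL)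
  from bruhat_elimination_step[OF this _ \<sigma>(1,2)] \<sigma>(3,4)
  have "\<exists>b'\<in>Borel n. \<exists>c'\<in>Borel n. \<exists>\<tau>. inj_on \<tau> {..<Suc k} \<and> \<tau> ` {..<Suc k} \<subseteq> {..<n} \<and>
    (\<forall>j<Suc k. \<forall>i<n. i \<noteq> \<tau> j \<longrightarrow> (b' * (b * g * c) * c') $$ (i,j) = 0) \<and>
    (\<forall>j<Suc k. \<forall>l<n. l \<noteq> j \<longrightarrow> (b' * (b * g * c) * c') $$ (\<tau> j,l) = 0)"
    using Suc.prems Suc_le_lessD by presburger
  then obtain b' c' \<tau> where bc': "b' \<in> Borel n" "c' \<in> Borel n"
    and \<tau>: "inj_on \<tau> {..<Suc k}" "\<tau> ` {..<Suc k} \<subseteq> {..<n}"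
      "\<forall>j<Suc k. \<forall>i<n. i \<noteq> \<tau> j \<longrightarrow> (b' * (b * g * c) * c') $$ (i,j) = 0"
      "\<forall>j<Suc k. \<forall>l<n. l \<noteq> j \<longrightarrow> (b' * (b * g * c) * c') $$ (\<tau> j,l) = 0"
    by blast
  note [simp] = SL_carrier[OF g] Borel_carrier[OF bc(1)] Borel_carrier[OF bc(2)]
    Borel_carrier[OF bc'(1)] Borel_carrier[OF bc'(2)]
  have "b' * (b * g * c) * c' = (b' * b) * g * (c * c')"
  proof -
    have "b' * (b * g * c) = b' * (b * g) * c"
      by (rule square_mult_assoc[of _ n, symmetric]) auto
    also have "b' * (b * g) = b' * b * g"
      by (rule square_mult_assoc[of _ n, symmetric]) auto
    finally have "b' * (b * g * c) * c' = b' * b * g * c * c'" by simp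
    also have "\<dots> = (b' * b) * g * (c * c')"
      by (rule square_mult_assoc[of _ n]) auto
    finally show ?thesis .
  qed
  then show ?case
    using \<tau> Borel_mult[OF bc'(1) bc(1)] Borel_mult[OF bc(2) bc'(2)] by metis
qed

text \<open>Once all columns are reduced, the pivot rows form a permutation. The last equation is
  recorded because it carries membership in a B-stable set from g over to M.\<close>

lemma bruhat_decomposition:
  assumes g: "g \<in> SL n"
  obtains b c v M where "b \<in> Borel n" "c \<in> Borel n" "v permutes {1..n}" "M \<in> monomial_mats n v"
    "g = b * M * c" "M = ginv n b * g * ginv n c"
proof -
  obtain b c \<sigma> where bc: "b \<in> Borel n" "c \<in> Borel n"
    and \<sigma>: "inj_on \<sigma> {..<n}" "\<sigma> ` {..<n} \<subseteq> {..<n}"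
      "\<forall>j<n. \<forall>i<n. i \<noteq> \<sigma> j \<longrightarrow> (b * g * c) $$ (i,j) = 0"
    using bruhat_elimination[OF g order_refl] by blast
  define M where "M = b * g * c"
  define v where "v x = (if x \<in> {1..n} then Suc (\<sigma> (x - 1)) else x)" for x
  have M: "M \<in> SL n" unfolding M_def using g bc by (auto intro!: SL_mult intro: Borel_SL)
  have v: "v permutes {1..n}"
  proof (rule bij_imp_permutes)
    have "inj_on v {1..n}"
    proof (rule inj_onI)
      fix x y assume "x \<in> {1..n}" "y \<in> {1..n}" "v x = v y"
      moreover from this have "x - 1 = y - 1"
        using inj_onD[OF \<sigma>(1), of "x - 1" "y - 1"] by (auto simp: v_def)
      ultimately show "x = y" by auto
    qed
    moreover have "v ` {1..n} \<subseteq> {1..n}"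
    proof
      fix y assume "y \<in> v ` {1..n}"
      then obtain x where x: "x \<in> {1..n}" "y = Suc (\<sigma> (x - 1))" by (auto simp: v_def)
      then have "x - 1 \<in> {..<n}" by auto
      then have "\<sigma> (x - 1) \<in> {..<n}" using \<sigma>(2) by blast
      then show "y \<in> {1..n}" using x by auto
    qed
    ultimately show "bij_betw v {1..n} {1..n}"
      unfolding bij_betw_def by (simp add: endo_inj_surj)
  qed (auto simp: v_def)
  have "M \<in> monomial_mats n v"
    using M \<sigma>(3) by (auto simp: monomial_mats_def v_def M_def[symmetric])
  moreover have "g = ginv n b * M * ginv n c"
    unfolding M_def using bc SL_carrier[OF g] by (intro double_coset_inverse)
  moreover have "M = ginv n (ginv n b) * g * ginv n (ginv n c)"
    using double_coset_inverse[OF Borel_ginv[OF bc(1)] Borel_ginv[OF bc(2)] SL_carrier[OF M]]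
      calculation(2) by simp
  ultimately show ?thesis using that Borel_ginv bc v by blast
qed

text \<open>Everything happens in rows r < s and columns p < q, where M has diagonal entries x and
  y. Adding t times column q to column p gives the rows (x, 0) and (t y, y). Adding -x / (t y) times
  the lower row to the upper and -1/t times the left column to the right leaves (0, -x/t) and (t y,
  0), the pattern with p and q exchanged. Both operations are upper triangular because r < s and p <
  q.\<close>

lemma monomial_perturbation:
  assumes M: "M \<in> monomial_mats n v" and v: "v permutes {1..n}"
    and pq: "p < q" "q < n" "v (Suc p) < v (Suc q)" and t: "t \<noteq> 0"
  shows "\<exists>b\<in>Borel n. \<exists>c\<in>Borel n. \<exists>N\<in>monomial_mats n (v \<circ> Transposition.transpose (Suc p) (Suc q)).
    addcol t p q M = b * N * c"
proof -
  define r s where "r = v (Suc p) - 1" and "s = v (Suc q) - 1"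
  have p: "p < n" using pq by simp
  note rb = permutes_bounds[OF v p, folded r_def] and sb = permutes_bounds[OF v pq(2), folded s_def]
  have rs: "r < s" using pq rb sb by simp
  define a where "a = - M $$ (r,p) / (t * M $$ (s,q))"
  define G where "G = addcol t p q M"
  define H where "H = addrow a r s G"
  define N where "N = addcol (- 1 / t) q p H"
  have cM: "M \<in> carrier_mat n n" "det M = 1"
    using monomial_SL[OF M] by (auto simp: SL_def)
  have c: "G \<in> carrier_mat n n" "H \<in> carrier_mat n n" "N \<in> carrier_mat n n"
    using carrier_matD[OF cM(1)] unfolding N_def H_def G_def by (intro carrier_matI; simp)+
  have "det G = 1" unfolding G_def using det_addcol[OF pq(2) _ cM(1), of p t] pq cM by simp
  then have "det H = 1" unfolding H_def using det_addrow[OF sb(1) _ c(1), of r a] rs by simp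
  then have det: "det N = 1" unfolding N_def using det_addcol[OF p _ c(2), of q "-1/t"] pq by simp
  have nz: "M $$ (s,q) \<noteq> 0"
    unfolding s_def using monomial_nonzero[OF M v pq(2)] .
  have Mz: "M $$ (i,j) = 0" if "i < n" "j < n" "Suc i \<noteq> v (Suc j)" for i j
    using monomial_zero[OF M that] .
  have G: "G $$ (i,j) = (if j = p then t * M $$ (i,q) + M $$ (i,p) else M $$ (i,j))"
    if "i < n" "j < n" for i j
    using that cM by (auto simp: G_def)
  have H: "H $$ (i,j) = (if i = r then a * G $$ (s,j) + G $$ (r,j) else G $$ (i,j))"
    if "i < n" "j < n" for i j
    using that c by (auto simp: H_def)
  have N: "N $$ (i,j) = (if j = q then - 1 / t * H $$ (i,p) + H $$ (i,q) else H $$ (i,j))"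
    if "i < n" "j < n" for i j
    using that c by (auto simp: N_def)
  have srp: "M $$ (s,p) = 0" "M $$ (r,q) = 0"
    using Mz[of s p] Mz[of r q] rb sb p pq by auto
  \<comment> \<open>The choice of \<open>a\<close> cancels the entry in row r, so column p of
    \<open>H\<close> is supported in row s. The final column operation then alters column q only in
    that row.\<close>
  have Hp: "H $$ (i,p) = 0" if "i < n" "i \<noteq> s" for i
  proof (cases "i = r")
    case True
    then show ?thesis using H[of r p] G[of r p] G[of s p] rb sb p srp nz t by (simp add: a_def)
  next
    case False
    then have "Suc i \<noteq> v (Suc p)" "Suc i \<noteq> v (Suc q)" using that rb sb by auto
    then show ?thesis using H[of i p] G[of i p] that p pq False Mz[of i p] Mz[of i q] by simp
  qed
  have Nz: "N $$ (i,j) = 0" if ij: "i < n" "j < n"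
    and ne: "Suc i \<noteq> (v \<circ> Transposition.transpose (Suc p) (Suc q)) (Suc j)" for i j
  proof -
    consider "j = p" | "j = q" | "j \<noteq> p" "j \<noteq> q" by blast
    then show ?thesis
    proof cases
      case 1
      then have "i \<noteq> s" using ne sb by auto
      then show ?thesis using 1 N[of i p] Hp[of i] ij pq by simp
    next
      case 2
      then have ir: "i \<noteq> r" using ne rb by auto
      show ?thesis
      proof (cases "i = s")
        case True
        then show ?thesis
          using 2 N[of s q] H[of s p] H[of s q] G[of s p] G[of s q] sb p pq rs t srp by simp
      next
        case False
        then have "Suc i \<noteq> v (Suc q)" using sb by auto
        then show ?thesis
          using 2 N[of i q] H[of i q] G[of i q] Hp[of i] Mz[of i q] ij pq ir False by simp
      qed
    next
      case 3
      then have "Suc i \<noteq> v (Suc j)" using ne by (auto simp: transpose_def)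
      moreover have "Suc r \<noteq> v (Suc j)" "Suc s \<noteq> v (Suc j)"
        using rb sb permutes_Suc_inj[OF v] 3 by auto
      ultimately show ?thesis
        using 3 N[of i j] H[of i j] G[of i j] G[of r j] G[of s j] Mz[of i j] Mz[of r j] Mz[of s j]
          ij rb sb by simp
    qed
  qed
  have "N \<in> monomial_mats n (v \<circ> Transposition.transpose (Suc p) (Suc q))"
    using Nz c det by (auto simp: monomial_mats_def SL_def)
  moreover have "N = addrow_mat n a r s * G * addrow_mat n (- 1 / t) p q"
    unfolding N_def H_def addcol_mat[OF c(2)[unfolded H_def] p]
    using addrow_mat[OF c(1) sb(1)] by simp
  moreover have "addrow_mat n a r s \<in> Borel n" "addrow_mat n (- 1 / t) p q \<in> Borel n"
    using rs sb pq by (auto intro: addrow_mat_Borel)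
  ultimately show ?thesis
    using double_coset_inverse[of "addrow_mat n a r s" n "addrow_mat n (- 1 / t) p q" G] c(1)
      Borel_ginv unfolding G_def[symmetric] by metis
qed

section \<open>Zariski topology\<close>

lemma poly_fun_sum:
  assumes "finite I" "\<And>i. i \<in> I \<Longrightarrow> f i \<in> poly_fun n"
  shows "(\<lambda>A. \<Sum>i\<in>I. f i A) \<in> poly_fun n"
  using assms
proof (induction I rule: finite_induct)
  case empty
  then show ?case using pf_const[of 0 n] by simp
next
  case (insert x F)
  then show ?case using pf_add[of "f x" n "\<lambda>A. \<Sum>i\<in>F. f i A"] by simp
qed

lemma poly_fun_prod:
  assumes "finite I" "\<And>i. i \<in> I \<Longrightarrow> f i \<in> poly_fun n"
  shows "(\<lambda>A. \<Prod>i\<in>I. f i A) \<in> poly_fun n"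
  using assms
proof (induction I rule: finite_induct)
  case empty
  then show ?case using pf_const[of 1 n] by simp
next
  case (insert x F)
  then show ?case using pf_mult[of "f x" n "\<lambda>A. \<Prod>i\<in>F. f i A"] by simp
qed

text \<open>Substitution of polynomials into a polynomial. Agreement is asked only on n by n
  matrices, where entries of products and adjugates are given by their usual formulas.\<close>

lemma poly_fun_compose:
  assumes f: "f \<in> poly_fun n"
    and \<phi>: "\<And>i j. i < n \<Longrightarrow> j < n \<Longrightarrow> \<exists>p\<in>poly_fun n. \<forall>A\<in>carrier_mat n n. p A = \<phi> A $$ (i,j)"
  shows "\<exists>f'\<in>poly_fun n. \<forall>A\<in>carrier_mat n n. f' A = f (\<phi> A)"
  using f
proof induction
  case (pf_const c)
  show ?case by (intro bexI[of _ "\<lambda>A. c"]) (auto intro: poly_fun.intros)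
next
  case (pf_coord i j)
  then show ?case using \<phi> by blast
next
  case (pf_add f g)
  then obtain f' g' where "f' \<in> poly_fun n" "g' \<in> poly_fun n"
    "\<forall>A\<in>carrier_mat n n. f' A = f (\<phi> A)" "\<forall>A\<in>carrier_mat n n. g' A = g (\<phi> A)" by blast
  then show ?case by (intro bexI[of _ "\<lambda>A. f' A + g' A"]) (auto intro: poly_fun.intros)
next
  case (pf_mult f g)
  then obtain f' g' where "f' \<in> poly_fun n" "g' \<in> poly_fun n"
    "\<forall>A\<in>carrier_mat n n. f' A = f (\<phi> A)" "\<forall>A\<in>carrier_mat n n. g' A = g (\<phi> A)" by blast
  then show ?case by (intro bexI[of _ "\<lambda>A. f' A * g' A"]) (auto intro: poly_fun.intros)
qed

lemma poly_fun_curve: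
  assumes f: "f \<in> poly_fun n"
    and \<gamma>: "\<And>i j. i < n \<Longrightarrow> j < n \<Longrightarrow> \<exists>p. \<forall>t. \<gamma> t $$ (i,j) = poly p t"
  shows "\<exists>p. \<forall>t. f (\<gamma> t) = poly p t"
  using f
proof induction
  case (pf_const c)
  show ?case by (intro exI[of _ "[:c:]"]) simp
next
  case (pf_coord i j)
  then show ?case using \<gamma> by blast
next
  case (pf_add f g)
  then obtain p q where "\<forall>t. f (\<gamma> t) = poly p t" "\<forall>t. g (\<gamma> t) = poly q t" by blast
  then show ?case by (intro exI[of _ "p + q"]) simp
next
  case (pf_mult f g)
  then obtain p q where "\<forall>t. f (\<gamma> t) = poly p t" "\<forall>t. g (\<gamma> t) = poly q t" by blast
  then show ?case by (intro exI[of _ "p * q"]) simp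
qed

lemma poly_fun_mult_entry:
  assumes b: "b \<in> carrier_mat n n" and c: "c \<in> carrier_mat n n" and ij: "i < n" "j < n"
  shows "\<exists>p\<in>poly_fun n. \<forall>A\<in>carrier_mat n n. p A = (b * A * c) $$ (i,j)"
proof
  show "(\<lambda>A. \<Sum>k<n. (\<Sum>l<n. b $$ (i,l) * A $$ (l,k)) * c $$ (k,j)) \<in> poly_fun n"
    by (intro poly_fun_sum poly_fun.intros) auto
  show "\<forall>A\<in>carrier_mat n n. (\<Sum>k<n. (\<Sum>l<n. b $$ (i,l) * A $$ (l,k)) * c $$ (k,j)) = (b * A * c) $$ (i,j)"
  proof
    fix A :: "complex mat" assume A: "A \<in> carrier_mat n n"
    have "(b * A * c) $$ (i,j) = (\<Sum>k<n. (b * A) $$ (i,k) * c $$ (k,j))"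
      using A b c ij by (intro mult_mat_entry) auto
    also have "\<dots> = (\<Sum>k<n. (\<Sum>l<n. b $$ (i,l) * A $$ (l,k)) * c $$ (k,j))"
      using A b ij by (intro sum.cong arg_cong2[of _ _ _ _ "(*)"] mult_mat_entry) auto
    finally show "(\<Sum>k<n. (\<Sum>l<n. b $$ (i,l) * A $$ (l,k)) * c $$ (k,j)) = (b * A * c) $$ (i,j)"
      by simp
  qed
qed

lemma poly_fun_adj_mat:
  assumes ij: "i < n" "j < n"
  shows "\<exists>p\<in>poly_fun n. \<forall>A\<in>carrier_mat n n. p A = adj_mat A $$ (i,j)"
proof
  \<comment> \<open>\<open>\<iota> r\<close> enumerates the indices other than r, so it translates
    indices of a minor into indices of the full matrix. The entry of the adjugate is then the
    Leibniz formula for that minor, up to sign.\<close>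
  define \<iota> where "\<iota> r k = (if k < r then k else Suc k)" for r k :: nat
  let ?p = "\<lambda>A::complex mat. (-1) ^ (j + i) * (\<Sum>p | p permutes {0..<n - 1}.
      of_int (sign p) * (\<Prod>k\<in>{0..<n - 1}. A $$ (\<iota> j k, \<iota> i (p k))))"
  have pk: "p k \<in> {0..<n - 1}" if "p \<in> {p. p permutes {0..<n - 1}}" "k \<in> {0..<n - 1}" for p k
    using permutes_in_image[of p "{0..<n - 1}" k] that by (simp only: mem_Collect_eq)
  have \<iota>: "\<iota> r k < n" if "k \<in> {0..<n - 1}" for r k
    using that by (auto simp: \<iota>_def)
  show "?p \<in> poly_fun n"
  proof (intro pf_mult pf_const poly_fun_sum poly_fun_prod pf_coord)
    show "finite {p. p permutes {0..<n - 1}}" by (intro finite_permutations) simp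
    show "\<iota> i (p k) < n" if "p \<in> {p. p permutes {0..<n - 1}}" "k \<in> {0..<n - 1}" for p k
      using pk[OF that] by (rule \<iota>)
    show "\<iota> j k < n" if "k \<in> {0..<n - 1}" for k using that by (rule \<iota>)
  qed simp
  show "\<forall>A\<in>carrier_mat n n. ?p A = adj_mat A $$ (i,j)"
  proof
    fix A :: "complex mat" assume A: "A \<in> carrier_mat n n"
    have "det (mat_delete A j i) = (\<Sum>p | p permutes {0..<n - 1}.
      of_int (sign p) * (\<Prod>k\<in>{0..<n - 1}. A $$ (\<iota> j k, \<iota> i (p k))))"
      unfolding det_def'[OF mat_delete_carrier[OF A]]
    proof (intro sum.cong refl arg_cong2[of _ _ _ _ "(*)"] prod.cong)
      fix p k assume "p \<in> {p. p permutes {0..<n - 1}}" "k \<in> {0..<n - 1}"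
      moreover from this have "p k \<in> {0..<n - 1}" by (rule pk)
      ultimately show "mat_delete A j i $$ (k, p k) = A $$ (\<iota> j k, \<iota> i (p k))"
        using A by (auto simp: mat_delete_def \<iota>_def)
    qed
    then show "?p A = adj_mat A $$ (i,j)"
      using A ij by (simp add: adj_mat_def cofactor_def)
  qed
qed

section \<open>The Zariski topologies on matrices, on the special linear group and on flags\<close>

lemma istopology_zariski:
  "istopology (\<lambda>U. U \<subseteq> carrier_mat n n \<and>
     (\<exists>F \<subseteq> poly_fun n. carrier_mat n n - U = {A \<in> carrier_mat n n. \<forall>f\<in>F. f A = 0}))"
  (is "istopology ?L")
  unfolding istopology_def
proof (intro conjI allI impI)
  fix U V assume U: "?L U" and V: "?L V"
  from U obtain F where F: "F \<subseteq> poly_fun n"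
    "carrier_mat n n - U = {A \<in> carrier_mat n n. \<forall>f\<in>F. f A = 0}" by blast
  from V obtain G where G: "G \<subseteq> poly_fun n"
    "carrier_mat n n - V = {A \<in> carrier_mat n n. \<forall>f\<in>G. f A = 0}" by blast
  \<comment> \<open>Pairwise products cut out the union of two zero sets, as the complex numbers
    have no zero divisors.\<close>
  define E where "E = (\<lambda>(f,g). \<lambda>A. f A * g A) ` (F \<times> G)"
  have "E \<subseteq> poly_fun n" using F G by (auto simp: E_def intro: pf_mult)
  moreover have "carrier_mat n n - U \<inter> V = {A \<in> carrier_mat n n. \<forall>f\<in>E. f A = 0}"
  proof -
    have "carrier_mat n n - U \<inter> V = (carrier_mat n n - U) \<union> (carrier_mat n n - V)" by blast
    also have "\<dots> = {A \<in> carrier_mat n n. \<forall>f\<in>E. f A = 0}"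
      unfolding F(2) G(2) by (auto simp: E_def)
    finally show ?thesis .
  qed
  ultimately show "U \<inter> V \<subseteq> carrier_mat n n"
    "\<exists>F\<subseteq>poly_fun n. carrier_mat n n - U \<inter> V = {A \<in> carrier_mat n n. \<forall>f\<in>F. f A = 0}"
    using U by blast+
next
  fix K assume K: "\<forall>U\<in>K. ?L U"
  then show "\<Union>K \<subseteq> carrier_mat n n" by blast
  from K have "\<forall>U\<in>K. \<exists>F. F \<subseteq> poly_fun n \<and>
      carrier_mat n n - U = {A \<in> carrier_mat n n. \<forall>f\<in>F. f A = 0}" by blast
  from bchoice[OF this] obtain F where F: "\<forall>U\<in>K. F U \<subseteq> poly_fun n \<and>
      carrier_mat n n - U = {A \<in> carrier_mat n n. \<forall>f\<in>F U. f A = 0}"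
    by (rule exE)
  have mem: "A \<notin> U \<longleftrightarrow> (\<forall>f\<in>F U. f A = 0)" if "U \<in> K" "A \<in> carrier_mat n n" for U A
  proof -
    have "A \<in> carrier_mat n n - U \<longleftrightarrow> A \<in> {A \<in> carrier_mat n n. \<forall>f\<in>F U. f A = 0}"
      using bspec[OF F that(1), THEN conjunct2] by (simp only:)
    then show ?thesis using that(2) by simp
  qed
  have "carrier_mat n n - \<Union>K = {A \<in> carrier_mat n n. \<forall>f\<in>\<Union>(F ` K). f A = 0}"
  proof (rule Set.set_eqI)
    fix A
    show "A \<in> carrier_mat n n - \<Union>K \<longleftrightarrow> A \<in> {A \<in> carrier_mat n n. \<forall>f\<in>\<Union>(F ` K). f A = 0}"
    proof (cases "A \<in> carrier_mat n n")
      case True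
      have "A \<notin> \<Union>K \<longleftrightarrow> (\<forall>U\<in>K. A \<notin> U)" by blast
      also have "\<dots> \<longleftrightarrow> (\<forall>U\<in>K. \<forall>f\<in>F U. f A = 0)" by (rule ball_cong[OF refl mem[OF _ True]])
      also have "\<dots> \<longleftrightarrow> (\<forall>f\<in>\<Union>(F ` K). f A = 0)" by blast
      finally show ?thesis using True by simp
    qed simp
  qed
  moreover have "\<Union>(F ` K) \<subseteq> poly_fun n" using F by (intro UN_least) simp
  ultimately show "\<exists>F\<subseteq>poly_fun n. carrier_mat n n - \<Union>K = {A \<in> carrier_mat n n. \<forall>f\<in>F. f A = 0}"
    by (intro exI conjI)
qed

lemma openin_zariski:
  "openin (zariski n) U \<longleftrightarrow> U \<subseteq> carrier_mat n n \<and>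
     (\<exists>F \<subseteq> poly_fun n. carrier_mat n n - U = {A \<in> carrier_mat n n. \<forall>f\<in>F. f A = 0})"
  unfolding zariski_def topology_inverse'[OF istopology_zariski] ..

lemma topspace_zariski: "topspace (zariski n) = carrier_mat n n"
proof -
  have "openin (zariski n) (carrier_mat n n)"
    unfolding openin_zariski
    by (auto intro!: exI[of _ "{\<lambda>A. 1}"] pf_const)
  then have "carrier_mat n n \<subseteq> topspace (zariski n)" by (rule openin_subset)
  moreover have "topspace (zariski n) \<subseteq> carrier_mat n n"
    using openin_topspace[of "zariski n"] unfolding openin_zariski by (rule conjunct1)
  ultimately show ?thesis by (rule subset_antisym[rotated])
qed

lemma closedin_zariski:
  "closedin (zariski n) C \<longleftrightarrow> (\<exists>F \<subseteq> poly_fun n. C = {A \<in> carrier_mat n n. \<forall>f\<in>F. f A = 0})"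
  (is "?l \<longleftrightarrow> ?r")
proof
  assume ?l
  then have "C \<subseteq> carrier_mat n n" "openin (zariski n) (carrier_mat n n - C)"
    by (simp_all only: closedin_def topspace_zariski)
  then show ?r by (simp only: openin_zariski double_diff subset_refl)
next
  assume ?r
  then have C: "C \<subseteq> carrier_mat n n" by blast
  then have "openin (zariski n) (carrier_mat n n - C)"
    using \<open>?r\<close> by (simp only: openin_zariski double_diff subset_refl Diff_subset simp_thms)
  then show ?l
    using C by (simp only: closedin_def topspace_zariski simp_thms)
qed

lemma topspace_SL_top: "topspace (SL_top n) = SL n"
  by (auto simp: SL_top_def topspace_zariski SL_def)

lemma closedin_SL_top:
  "closedin (SL_top n) C \<longleftrightarrow> (\<exists>F \<subseteq> poly_fun n. C = {g \<in> SL n. \<forall>f\<in>F. f g = 0})"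
proof -
  have eq: "{A \<in> carrier_mat n n. \<forall>f\<in>F. f A = 0} \<inter> SL n = {g \<in> SL n. \<forall>f\<in>F. f g = 0}" for F
    by (auto simp: SL_def)
  show ?thesis
    unfolding SL_top_def closedin_subtopology closedin_zariski eq[symmetric] by blast
qed

lemma istopology_flag_top:
  "istopology (\<lambda>U. U \<subseteq> flags n \<and> openin (SL_top n) {g \<in> SL n. cosetB n g \<in> U})"
  unfolding istopology_def
proof (intro conjI allI impI)
  fix U V
  assume U: "U \<subseteq> flags n \<and> openin (SL_top n) {g \<in> SL n. cosetB n g \<in> U}"
    and V: "V \<subseteq> flags n \<and> openin (SL_top n) {g \<in> SL n. cosetB n g \<in> V}"
  then show "U \<inter> V \<subseteq> flags n" by blast
  have "{g \<in> SL n. cosetB n g \<in> U \<inter> V} = {g \<in> SL n. cosetB n g \<in> U} \<inter> {g \<in> SL n. cosetB n g \<in> V}"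
    by blast
  then show "openin (SL_top n) {g \<in> SL n. cosetB n g \<in> U \<inter> V}" using U V by auto
next
  fix K assume K: "\<forall>U\<in>K. U \<subseteq> flags n \<and> openin (SL_top n) {g \<in> SL n. cosetB n g \<in> U}"
  then show "\<Union>K \<subseteq> flags n" by blast
  have "{g \<in> SL n. cosetB n g \<in> \<Union>K} = (\<Union>U\<in>K. {g \<in> SL n. cosetB n g \<in> U})" by blast
  then show "openin (SL_top n) {g \<in> SL n. cosetB n g \<in> \<Union>K}" using K by auto
qed

lemma openin_flag_top:
  "openin (flag_top n) U \<longleftrightarrow> U \<subseteq> flags n \<and> openin (SL_top n) {g \<in> SL n. cosetB n g \<in> U}"
  unfolding flag_top_def topology_inverse'[OF istopology_flag_top] ..

lemma topspace_flag_top: "topspace (flag_top n) = flags n"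
proof -
  have "{g \<in> SL n. cosetB n g \<in> flags n} = topspace (SL_top n)"
    by (auto simp: topspace_SL_top flags_def)
  then have "openin (flag_top n) (flags n)" by (simp add: openin_flag_top)
  then have "flags n \<subseteq> topspace (flag_top n)" by (rule openin_subset)
  moreover have "topspace (flag_top n) \<subseteq> flags n"
    using openin_topspace[of "flag_top n"] unfolding openin_flag_top by (rule conjunct1)
  ultimately show ?thesis by (rule subset_antisym[rotated])
qed

lemma closedin_flag_top:
  "closedin (flag_top n) C \<longleftrightarrow> C \<subseteq> flags n \<and>
    (\<exists>F \<subseteq> poly_fun n. {g \<in> SL n. cosetB n g \<in> C} = {g \<in> SL n. \<forall>f\<in>F. f g = 0})"
proof -
  have "{g \<in> SL n. cosetB n g \<in> flags n - C} = topspace (SL_top n) - {g \<in> SL n. cosetB n g \<in> C}"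
    by (auto simp: topspace_SL_top flags_def)
  moreover have "{g \<in> SL n. cosetB n g \<in> C} \<subseteq> topspace (SL_top n)"
    by (auto simp: topspace_SL_top)
  ultimately have "closedin (flag_top n) C \<longleftrightarrow>
      C \<subseteq> flags n \<and> closedin (SL_top n) {g \<in> SL n. cosetB n g \<in> C}"
    by (auto simp: closedin_def topspace_flag_top openin_flag_top)
  then show ?thesis unfolding closedin_SL_top .
qed

text \<open>Stated through vanishing polynomials rather than closed sets, so that polynomials can be
  pulled back directly along multiplications and along curves.\<close>

definition zariski_closure :: "nat \<Rightarrow> complex mat set \<Rightarrow> complex mat set" where
  "zariski_closure n S =
     {A \<in> carrier_mat n n. \<forall>f\<in>poly_fun n. (\<forall>s\<in>S. f s = 0) \<longrightarrow> f A = 0}"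

lemma zariski_closure_carrier: "A \<in> zariski_closure n S \<Longrightarrow> A \<in> carrier_mat n n"
  by (simp only: zariski_closure_def mem_Collect_eq)

lemma zariski_closure_vanish:
  "A \<in> zariski_closure n S \<Longrightarrow> f \<in> poly_fun n \<Longrightarrow> (\<And>s. s \<in> S \<Longrightarrow> f s = 0) \<Longrightarrow> f A = 0"
  unfolding zariski_closure_def mem_Collect_eq by (drule conjunct2, drule bspec) (assumption, simp)

lemma zariski_closure_superset: "s \<in> S \<Longrightarrow> s \<in> carrier_mat n n \<Longrightarrow> s \<in> zariski_closure n S"
  by (simp add: zariski_closure_def)

text \<open>A polynomial vanishing on S, pulled back along the multiplication, is again a polynomial
  vanishing on S.\<close>

lemma zariski_closure_mult:
  assumes S: "S \<subseteq> carrier_mat n n" and b: "b \<in> carrier_mat n n" and c: "c \<in> carrier_mat n n"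
    and inv: "\<And>s. s \<in> S \<Longrightarrow> b * s * c \<in> S" and A: "A \<in> zariski_closure n S"
  shows "b * A * c \<in> zariski_closure n S"
  unfolding zariski_closure_def
proof (intro CollectI conjI ballI impI)
  show "b * A * c \<in> carrier_mat n n"
    using zariski_closure_carrier[OF A] b c by simp
  fix f assume f: "f \<in> poly_fun n" and f0: "\<forall>s\<in>S. f s = 0"
  obtain f' where f': "f' \<in> poly_fun n" "\<forall>A\<in>carrier_mat n n. f' A = f (b * A * c)"
    using poly_fun_compose[OF f poly_fun_mult_entry[OF b c]] by blast
  have "f' s = 0" if "s \<in> S" for s
    using f'(2) subsetD[OF S that] f0 inv[OF that] by simp
  then have "f' A = 0" by (rule zariski_closure_vanish[OF A f'(1)])
  then show "f (b * A * c) = 0" using f'(2) zariski_closure_carrier[OF A] by simp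
qed

text \<open>Along the curve a polynomial vanishing on S becomes a polynomial in t with infinitely
  many roots, hence zero also at t = 0.\<close>

lemma zariski_closure_curve:
  assumes \<gamma>: "\<And>i j. i < n \<Longrightarrow> j < n \<Longrightarrow> \<exists>p. \<forall>t. \<gamma> t $$ (i,j) = poly p t"
    and carr: "\<gamma> 0 \<in> carrier_mat n n" and gen: "\<And>t. t \<noteq> 0 \<Longrightarrow> \<gamma> t \<in> zariski_closure n S"
  shows "\<gamma> 0 \<in> zariski_closure n S"
  unfolding zariski_closure_def
proof (intro CollectI conjI ballI impI)
  fix f assume f: "f \<in> poly_fun n" and f0: "\<forall>s\<in>S. f s = 0"
  obtain p where p: "\<And>t. f (\<gamma> t) = poly p t" using poly_fun_curve[OF f \<gamma>] by blast
  have "poly p t = 0" if "t \<noteq> 0" for t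
    using zariski_closure_vanish[OF gen[OF that] f] f0 p[of t] by simp
  then have "UNIV - {0} \<subseteq> {t. poly p t = 0}" by auto
  then have "infinite {t. poly p t = 0}"
    using infinite_UNIV_char_0 by (metis finite.emptyI finite_Diff2 finite_insert finite_subset)
  then have "p = 0" using poly_roots_finite by blast
  then show "f (\<gamma> 0) = 0" using p by simp
qed (rule carr)

section \<open>Double cosets and their closures\<close>

definition double_coset :: "nat \<Rightarrow> (nat \<Rightarrow> nat) \<Rightarrow> complex mat set" where
  "double_coset n w = {b * perm_rep n w * c | b c. b \<in> Borel n \<and> c \<in> Borel n}"

text \<open>Column 0 of the inverse of g lists the coordinates of the first standard basis vector in the
  basis of columns of g, so both conditions depend only on the flag of g.\<close>

definition hess_piece :: "nat \<Rightarrow> nat \<Rightarrow> nat \<Rightarrow> complex mat set" where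
  "hess_piece n a b = {g \<in> SL n. (\<forall>i<n. a \<le> i \<longrightarrow> ginv n g $$ (i,0) = 0) \<and>
     (\<forall>j<n. Suc j < b \<longrightarrow> g $$ (n - 1,j) = 0)}"

text \<open>Upper triangular matrices neither push the support of a column downwards from the left
  nor destroy leading zeros of a row from the right.\<close>

lemma hess_piece_mult_right:
  assumes g: "g \<in> hess_piece n a b" and c: "c \<in> Borel n"
  shows "g * c \<in> hess_piece n a b"
proof -
  have gS: "g \<in> SL n" using g by (simp add: hess_piece_def)
  note gi = ginv_SL[OF gS]
  have "ginv n (g * c) $$ (i,0) = 0" if i: "i < n" "a \<le> i" for i
  proof -
    have "ginv n c $$ (i,k) * ginv n g $$ (k,0) = 0" if "k < n" for k
      using Borel_zero[OF Borel_ginv[OF c], of i k] g i that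
      by (cases "k < i") (auto simp: hess_piece_def)
    then show ?thesis
      unfolding ginv_mult[OF gS Borel_SL[OF c]] using i
      by (intro mult_mat_entry_zero[OF Borel_carrier[OF Borel_ginv[OF c]] SL_carrier[OF gi]]) auto
  qed
  moreover have "(g * c) $$ (n - 1,j) = 0" if j: "j < n" "Suc j < b" for j
  proof -
    have "g $$ (n - 1,k) * c $$ (k,j) = 0" if "k < n" for k
      using Borel_zero[OF c that, of j] g j that by (cases "j < k") (auto simp: hess_piece_def)
    then show ?thesis
      using j by (intro mult_mat_entry_zero[OF SL_carrier[OF gS] Borel_carrier[OF c]]) auto
  qed
  ultimately show ?thesis
    using SL_mult[OF gS Borel_SL[OF c]] by (simp add: hess_piece_def)
qed

text \<open>The first column of the inverse of c is a multiple of the first basis vector and the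
  last row of c a multiple of the last one, so the two vectors in question are merely
  rescaled.\<close>

lemma hess_piece_mult_left:
  assumes g: "g \<in> hess_piece n a b" and c: "c \<in> Borel n"
  shows "c * g \<in> hess_piece n a b"
proof -
  have gS: "g \<in> SL n" using g by (simp add: hess_piece_def)
  note gi = ginv_SL[OF gS]
  have "ginv n (c * g) $$ (i,0) = 0" if i: "i < n" "a \<le> i" for i
  proof -
    have "ginv n g $$ (i,k) * ginv n c $$ (k,0) = 0" if "k < n" for k
      using Borel_zero[OF Borel_ginv[OF c] that, of 0] g i
      by (cases "k = 0") (auto simp: hess_piece_def)
    then show ?thesis
      unfolding ginv_mult[OF Borel_SL[OF c] gS] using i
      by (intro mult_mat_entry_zero[OF SL_carrier[OF gi] Borel_carrier[OF Borel_ginv[OF c]]]) auto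
  qed
  moreover have "(c * g) $$ (n - 1,j) = 0" if j: "j < n" "Suc j < b" for j
  proof -
    have "c $$ (n - 1,k) * g $$ (k,j) = 0" if "k < n" for k
      using Borel_zero[OF c, of "n - 1" k] g j that
      by (cases "k = n - 1") (auto simp: hess_piece_def)
    then show ?thesis
      using j by (intro mult_mat_entry_zero[OF Borel_carrier[OF c] SL_carrier[OF gS]]) auto
  qed
  ultimately show ?thesis
    using SL_mult[OF Borel_SL[OF c] gS] by (simp add: hess_piece_def)
qed

lemma monomial_in_hess_piece:
  assumes M: "M \<in> monomial_mats n v" and v: "v permutes {1..n}" and n: "n > 0"
    and st: "v s = 1" "v t = n"
  shows "M \<in> hess_piece n a b \<longleftrightarrow> s \<le> a \<and> b \<le> t"
proof -
  have MS: "M \<in> SL n" using M by (rule monomial_SL)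
  have s: "s \<in> {1..n}" "t \<in> {1..n}"
    using permutes_in_image[OF v, of s] permutes_in_image[OF v, of t] st n by auto
  have vs: "v x = 1 \<longleftrightarrow> x = s" "v x = n \<longleftrightarrow> x = t" for x
    using permutes_inj[OF v] st by (metis injD)+
  have inv: "ginv n M $$ (i,0) = 0 \<longleftrightarrow> Suc i \<noteq> s" if i: "i < n" for i
  proof -
    \<comment> \<open>Row r of M has its only nonzero entry in column i, so entry (r,0) of M times
      its inverse isolates entry (i,0) of the inverse.\<close>
    define r where "r = v (Suc i) - 1"
    note r = permutes_bounds[OF v i, folded r_def]
    have "(M * ginv n M) $$ (r,0) = (\<Sum>k<n. M $$ (r,k) * ginv n M $$ (k,0))"
      using r n by (intro mult_mat_entry SL_carrier[OF MS] SL_carrier[OF ginv_SL[OF MS]]) auto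
    also have "\<dots> = (\<Sum>k<n. if k = i then M $$ (r,i) * ginv n M $$ (i,0) else 0)"
    proof (intro sum.cong refl)
      fix k assume k: "k \<in> {..<n}"
      show "M $$ (r,k) * ginv n M $$ (k,0) = (if k = i then M $$ (r,i) * ginv n M $$ (i,0) else 0)"
      proof (cases "k = i")
        case False
        then have "Suc r \<noteq> v (Suc k)" using r permutes_Suc_inj[OF v] by simp
        then show ?thesis using monomial_zero[OF M r(1), of k] k False by simp
      qed simp
    qed
    also have "\<dots> = M $$ (r,i) * ginv n M $$ (i,0)" using i by simp
    finally have "M $$ (r,i) * ginv n M $$ (i,0) = (if r = 0 then 1 else 0)"
      using r n by (simp add: ginv_right[OF MS])
    moreover have "M $$ (r,i) \<noteq> 0" unfolding r_def by (rule monomial_nonzero[OF M v i])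
    moreover have "r = 0 \<longleftrightarrow> Suc i = s" using vs(1)[of "Suc i"] r by auto
    ultimately show ?thesis by (auto split: if_splits)
  qed
  have last: "M $$ (n - 1,j) = 0 \<longleftrightarrow> Suc j \<noteq> t" if j: "j < n" for j
  proof (cases "Suc j = t")
    case True
    then show ?thesis using monomial_nonzero[OF M v j] st by simp
  next
    case False
    then have "Suc (n - 1) \<noteq> v (Suc j)" using vs(2)[of "Suc j"] n by auto
    then show ?thesis using monomial_zero[OF M _ j, of "n - 1"] n False by simp
  qed
  have "(\<forall>i<n. a \<le> i \<longrightarrow> Suc i \<noteq> s) \<longleftrightarrow> s \<le> a"
  proof
    assume "\<forall>i<n. a \<le> i \<longrightarrow> Suc i \<noteq> s"
    then have "\<not> a \<le> s - 1" using s by (metis Suc_pred' atLeastAtMost_iff less_eq_Suc_le One_nat_def)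
    then show "s \<le> a" by simp
  qed auto
  moreover have "(\<forall>j<n. Suc j < b \<longrightarrow> Suc j \<noteq> t) \<longleftrightarrow> b \<le> t"
  proof
    assume "\<forall>j<n. Suc j < b \<longrightarrow> Suc j \<noteq> t"
    then have "\<not> t < b" using s by (metis Suc_pred' atLeastAtMost_iff less_eq_Suc_le One_nat_def)
    then show "b \<le> t" by simp
  qed auto
  ultimately show ?thesis using MS inv last by (simp add: hess_piece_def)
qed

lemma double_coset_mult:
  assumes "w permutes {1..n}" "n > 0" "b \<in> Borel n" "c \<in> Borel n" "s \<in> double_coset n w"
  shows "b * s * c \<in> double_coset n w"
proof -
  obtain b' c' where s: "b' \<in> Borel n" "c' \<in> Borel n" "s = b' * perm_rep n w * c'"
    using assms by (auto simp: double_coset_def)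
  note [simp] = Borel_carrier[OF assms(3)] Borel_carrier[OF assms(4)] Borel_carrier[OF s(1)]
    Borel_carrier[OF s(2)] SL_carrier[OF monomial_SL[OF perm_rep_monomial[OF assms(1,2)]]]
  have "b * s = b * (b' * perm_rep n w) * c'"
    unfolding s by (rule square_mult_assoc[of _ n, symmetric]) auto
  also have "b * (b' * perm_rep n w) = b * b' * perm_rep n w"
    by (rule square_mult_assoc[of _ n, symmetric]) auto
  finally have "b * s * c = b * b' * perm_rep n w * c' * c" by simp
  also have "\<dots> = b * b' * perm_rep n w * (c' * c)"
    by (rule square_mult_assoc[of _ n]) auto
  finally show ?thesis
    using Borel_mult[OF assms(3) s(1)] Borel_mult[OF s(2) assms(4)] by (auto simp: double_coset_def)
qed

lemma double_coset_SL:
  assumes "w permutes {1..n}" "n > 0"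
  shows "double_coset n w \<subseteq> SL n"
  using monomial_SL[OF perm_rep_monomial[OF assms]]
  by (auto simp: double_coset_def intro!: SL_mult intro: Borel_SL)

lemma monomial_in_double_coset:
  assumes "w permutes {1..n}" "n > 0" "M \<in> monomial_mats n w"
  shows "M \<in> double_coset n w"
proof -
  obtain d where "d \<in> Borel n" "M = perm_rep n w * d"
    using monomial_mats_torus[OF assms(3) perm_rep_monomial[OF assms(1,2)] assms(1)] by blast
  moreover have "1\<^sub>m n * perm_rep n w = perm_rep n w"
    using SL_carrier[OF monomial_SL[OF perm_rep_monomial[OF assms(1,2)]]] by simp
  ultimately have "M = 1\<^sub>m n * perm_rep n w * d" by simp
  then show ?thesis
    unfolding double_coset_def using Borel_one[of n] \<open>d \<in> Borel n\<close> by blast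
qed

lemma hess_piece_subset_zariski_closure:
  assumes ab: "a \<in> {1..n}" "b \<in> {1..n}" "a \<noteq> b" and w: "decreasing_off n a b w"
  shows "hess_piece n a b \<subseteq> zariski_closure n (double_coset n w)"
proof
  let ?K = "zariski_closure n (double_coset n w)"
  have n: "n > 0" using ab by auto
  have wp: "w permutes {1..n}" using w by (simp add: decreasing_off_def)
  \<comment> \<open>Stability serves twice: it places the perturbed matrices, given as Borel
    multiples of monomial ones, in \<open>?K\<close>, and it returns at the end from the monomial
    matrix M to g.\<close>
  have stable: "b * g * c \<in> ?K" if "g \<in> ?K" "b \<in> Borel n" "c \<in> Borel n" for b g c
    using double_coset_SL[OF wp n] that double_coset_mult[OF wp n that(2,3)]
    by (intro zariski_closure_mult) (auto intro: SL_carrier Borel_carrier)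
  have "monomial_mats n v \<subseteq> ?K" if "v permutes {1..n}" "v s = 1" "s \<le> a" "v t = n" "b \<le> t" for v s t
    using ab that
  proof (rule bruhat_descent_induct)
    fix u assume "decreasing_off n a b u"
    then have "u = w" using w by (rule decreasing_off_unique)
    show "monomial_mats n u \<subseteq> ?K"
    proof
      fix M assume M: "M \<in> monomial_mats n u"
      then have "M \<in> double_coset n w" "M \<in> carrier_mat n n"
        using monomial_in_double_coset[OF wp n] \<open>u = w\<close> by (auto intro: SL_carrier monomial_SL)
      then show "M \<in> ?K" by (rule zariski_closure_superset)
    qed
  next
    fix u p q
    assume u: "u permutes {1..n}" and pq: "p \<in> {1..n}" "q \<in> {1..n}" "p < q" "u p < u q"
      and IH: "monomial_mats n (u \<circ> Transposition.transpose p q) \<subseteq> ?K"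
    obtain p' q' where p': "p = Suc p'" "q = Suc q'"
      using pq by (metis atLeastAtMost_iff not0_implies_Suc not_one_le_zero)
    show "monomial_mats n u \<subseteq> ?K"
    proof
      fix M assume M: "M \<in> monomial_mats n u"
      have cM: "M \<in> carrier_mat n n" using M by (intro SL_carrier monomial_SL)
      have zero: "addcol 0 p' q' M = M" by (rule eq_matI) (use cM in auto)
      have "addcol 0 p' q' M \<in> ?K"
      proof (rule zariski_closure_curve[where \<gamma> = "\<lambda>t. addcol t p' q' M"])
        fix i j assume ij: "i < n" "j < n"
        show "\<exists>P. \<forall>t. addcol t p' q' M $$ (i,j) = poly P t"
          by (rule exI[of _ "if p' = j then [:M $$ (i,j), M $$ (i,q'):] else [:M $$ (i,j):]"])
            (use ij cM in auto)
      next
        fix t :: complex assume t: "t \<noteq> 0"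
        obtain b c N where "b \<in> Borel n" "c \<in> Borel n"
          "N \<in> monomial_mats n (u \<circ> Transposition.transpose p q)" "addcol t p' q' M = b * N * c"
          using monomial_perturbation[OF M u, of p' q' t] pq t unfolding p' by auto
        then show "addcol t p' q' M \<in> ?K" using stable IH by auto
      qed (use zero cM in auto)
      then show "M \<in> ?K" using zero by simp
    qed
  qed
  note mono = this
  fix g assume g: "g \<in> hess_piece n a b"
  then have "g \<in> SL n" by (simp add: hess_piece_def)
  then obtain b' c v M where d: "b' \<in> Borel n" "c \<in> Borel n" "v permutes {1..n}"
    "M \<in> monomial_mats n v" "g = b' * M * c" "M = ginv n b' * g * ginv n c"
    using bruhat_decomposition by blast
  \<comment> \<open>M arises from g by Borel factors on both sides, so it stays in the piece; the
    positions s and t then satisfy the inequalities needed for the descent.\<close>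
  have "M \<in> hess_piece n a b"
    unfolding d(6) by (intro hess_piece_mult_left hess_piece_mult_right Borel_ginv g d)
  moreover obtain s t where st: "v s = 1" "v t = n"
    using permutes_surj[OF d(3)] by (metis surjD)
  ultimately have "s \<le> a" "b \<le> t" using monomial_in_hess_piece[OF d(4,3) n st] by auto
  then have "M \<in> ?K" using mono[OF d(3) st(1) _ st(2)] d(4) by auto
  then show "g \<in> ?K" using stable[OF _ d(1,2)] d(5) by simp
qed

section \<open>Schubert varieties\<close>

text \<open>The piece is a union of cosets by right stability, so it is the full preimage of its
  image among flags. This is what lets closedness descend to the quotient.\<close>

lemma cosetB_in_hess_piece_iff:
  assumes "g \<in> SL n"
  shows "cosetB n g \<in> cosetB n ` hess_piece n a b \<longleftrightarrow> g \<in> hess_piece n a b"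
proof
  assume "cosetB n g \<in> cosetB n ` hess_piece n a b"
  then obtain k where k: "k \<in> hess_piece n a b" "cosetB n k = cosetB n g" by auto
  then obtain c where "c \<in> Borel n" "g = k * c"
    using cosetB_eqD[OF k(2) SL_carrier[OF assms]] by blast
  then show "g \<in> hess_piece n a b" using k hess_piece_mult_right by blast
qed auto

lemma closedin_hess_piece:
  assumes n: "n > 0"
  shows "closedin (flag_top n) (cosetB n ` hess_piece n a b)"
  unfolding closedin_flag_top
proof (intro conjI)
  show "cosetB n ` hess_piece n a b \<subseteq> flags n" by (auto simp: flags_def hess_piece_def)
  have "\<forall>i. \<exists>p. i < n \<longrightarrow> p \<in> poly_fun n \<and> (\<forall>A\<in>carrier_mat n n. p A = adj_mat A $$ (i,0))"
    using poly_fun_adj_mat[of _ n 0] n by blast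
  then obtain P where P: "\<And>i. i < n \<Longrightarrow> P i \<in> poly_fun n"
    "\<And>i A. i < n \<Longrightarrow> A \<in> carrier_mat n n \<Longrightarrow> P i A = adj_mat A $$ (i,0)"
    by metis
  \<comment> \<open>The equations are the lower entries of the first column of the adjugate and the
    initial entries of the last row.\<close>
  define F where "F = P ` {i. i < n \<and> a \<le> i} \<union> (\<lambda>j A. A $$ (n - 1,j)) ` {j. j < n \<and> Suc j < b}"
  have "F \<subseteq> poly_fun n" using P n by (auto simp: F_def intro: pf_coord)
  moreover have "{g \<in> SL n. cosetB n g \<in> cosetB n ` hess_piece n a b} = {g \<in> SL n. \<forall>f\<in>F. f g = 0}"
  proof -
    have vanish: "(\<forall>f\<in>F. f g = 0) \<longleftrightarrow> g \<in> hess_piece n a b" if g: "g \<in> SL n" for g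
    proof -
      have "P i g = ginv n g $$ (i,0)" if "i < n" for i
        using P(2)[OF that SL_carrier[OF g]] ginv_eq_adj_mat[OF g] by simp
      then show ?thesis using g unfolding F_def hess_piece_def by (auto simp: ball_Un)
    qed
    show ?thesis
      by (intro Collect_cong conj_cong refl) (simp only: vanish cosetB_in_hess_piece_iff)
  qed
  ultimately show "\<exists>F\<subseteq>poly_fun n. {g \<in> SL n. cosetB n g \<in> cosetB n ` hess_piece n a b} =
      {g \<in> SL n. \<forall>f\<in>F. f g = 0}" by blast
qed

text \<open>The cell lies in the piece by left stability, and the piece is closed. Conversely,
  equations of the closure, pulled back to matrices, vanish on the double coset and therefore on its
  Zariski closure, which contains the piece.\<close>

lemma schubert_eq_hess_piece:
  assumes ab: "a \<in> {1..n}" "b \<in> {1..n}" "a \<noteq> b" and w: "decreasing_off n a b w"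
  shows "schubert n w = cosetB n ` hess_piece n a b"
proof -
  have n: "n > 0" using ab by auto
  have wp: "w permutes {1..n}" "w a = 1" "w b = n" using w by (auto simp: decreasing_off_def)
  define S where "S = {cosetB n (c * perm_rep n w) | c. c \<in> Borel n}"
  note wSL = monomial_SL[OF perm_rep_monomial[OF wp(1) n]]
  have S: "cosetB n s \<in> S" if "s \<in> double_coset n w" for s
  proof -
    from that obtain b c where "b \<in> Borel n" "c \<in> Borel n" "s = b * perm_rep n w * c"
      by (auto simp: double_coset_def)
    then show ?thesis
      using cosetB_mult[of "b * perm_rep n w" n c] SL_carrier[OF wSL] Borel_carrier[of b n]
      by (auto simp: S_def)
  qed
  have "S \<subseteq> cosetB n ` hess_piece n a b"
  proof
    fix x assume "x \<in> S"
    then obtain c where c: "c \<in> Borel n" "x = cosetB n (c * perm_rep n w)" by (auto simp: S_def)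
    have "perm_rep n w \<in> hess_piece n a b"
      using monomial_in_hess_piece[OF perm_rep_monomial[OF wp(1) n] wp(1) n wp(2,3)] by simp
    then show "x \<in> cosetB n ` hess_piece n a b" using c hess_piece_mult_left by blast
  qed
  moreover from this have "S \<subseteq> flags n" by (auto simp: flags_def hess_piece_def)
  moreover have "cosetB n ` hess_piece n a b \<subseteq> flag_top n closure_of S"
  proof
    fix x assume "x \<in> cosetB n ` hess_piece n a b"
    then obtain g where g: "g \<in> hess_piece n a b" "x = cosetB n g" by auto
    then have gS: "g \<in> SL n" by (simp add: hess_piece_def)
    have "closedin (flag_top n) (flag_top n closure_of S)" by simp
    then obtain F where F: "F \<subseteq> poly_fun n"
      "{g \<in> SL n. cosetB n g \<in> flag_top n closure_of S} = {g \<in> SL n. \<forall>f\<in>F. f g = 0}"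
      unfolding closedin_flag_top by blast
    have "S \<subseteq> flag_top n closure_of S"
      using \<open>S \<subseteq> flags n\<close> by (intro closure_of_subset) (simp add: topspace_flag_top)
    then have "double_coset n w \<subseteq> {g \<in> SL n. \<forall>f\<in>F. f g = 0}"
      unfolding F(2)[symmetric] using S double_coset_SL[OF wp(1) n] by blast
    then have vanish: "f s = 0" if "f \<in> F" "s \<in> double_coset n w" for f s
      using that by blast
    have "f g = 0" if "f \<in> F" for f
      by (rule zariski_closure_vanish[OF subsetD[OF hess_piece_subset_zariski_closure[OF ab w] g(1)]
            subsetD[OF F(1) that]]) (rule vanish[OF that])
    then have "g \<in> {g \<in> SL n. \<forall>f\<in>F. f g = 0}" using gS by simp
    then show "x \<in> flag_top n closure_of S" unfolding F(2)[symmetric] g(2) by simp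
  qed
  ultimately show ?thesis
    unfolding schubert_def S_def[symmetric]
    using closure_of_minimal[OF _ closedin_hess_piece[OF n]] by blast
qed

lemma Borel_unipotent_torus:
  assumes b: "b \<in> Borel n"
  obtains u d where "u \<in> carrier_mat n n" "\<And>i. i < n \<Longrightarrow> u $$ (i,i) = 1"
    "\<And>i j. i < n \<Longrightarrow> j < i \<Longrightarrow> u $$ (i,j) = 0" "d \<in> monomial_mats n id" "b = u * d"
proof
  \<comment> \<open>Each column of b is divided by its diagonal entry; \<open>d\<close> collects
    these entries.\<close>
  define u where "u = mat n n (\<lambda>(i,j). b $$ (i,j) / b $$ (j,j))"
  define d where "d = mat n n (\<lambda>(i,j). if i = j then b $$ (j,j) else 0)"
  show c: "u \<in> carrier_mat n n" by (simp add: u_def)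
  show diag: "\<And>i. i < n \<Longrightarrow> u $$ (i,i) = 1" using Borel_diag_nonzero[OF b] by (simp add: u_def)
  show zero: "\<And>i j. i < n \<Longrightarrow> j < i \<Longrightarrow> u $$ (i,j) = 0"
    using Borel_zero[OF b] by (simp add: u_def)
  have u: "u \<in> Borel n" using c diag zero by (rule unitriangular_Borel)
  have cd: "d \<in> carrier_mat n n" by (simp add: d_def)
  show eq: "b = u * d"
  proof (rule eq_matI)
    fix i j assume "i < dim_row (u * d)" "j < dim_col (u * d)"
    then have ij: "i < n" "j < n" using c cd by auto
    have "(u * d) $$ (i,j) = (\<Sum>k<n. u $$ (i,k) * d $$ (k,j))" using c cd ij by (rule mult_mat_entry)
    also have "\<dots> = (\<Sum>k<n. if k = j then b $$ (i,j) else 0)"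
      using ij Borel_diag_nonzero[OF b] by (intro sum.cong) (auto simp: u_def d_def)
    finally show "b $$ (i,j) = (u * d) $$ (i,j)" using ij by simp
  qed (use c cd Borel_carrier[OF b] in auto)
  have "det d = 1" using det_mult[OF c cd] u b eq by (auto simp: Borel_def SL_def)
  then show "d \<in> monomial_mats n id" using cd by (auto simp: monomial_mats_def SL_def d_def)
qed

lemma irreducible_schubert:
  assumes w: "w permutes {1..n}" and n: "n > 0"
  shows "irreducible_in (flag_top n) (schubert n w)"
  unfolding schubert_def
proof (rule irreducible_in_closure_of)
  let ?w = "perm_rep n w"
  let ?U = "{u \<in> carrier_mat n n. (\<forall>i<n. u $$ (i,i) = 1) \<and> (\<forall>i<n. \<forall>j<i. u $$ (i,j) = 0)}"
  note wM = perm_rep_monomial[OF w n]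
  note wSL = monomial_SL[OF wM] 
  note wc = SL_carrier[OF wSL]
  have UB: "?U \<subseteq> Borel n" using unitriangular_Borel by blast
  define S where "S = {cosetB n (b * ?w) | b. b \<in> Borel n}"
  \<comment> \<open>The torus factor can be discarded: \<open>d\<close> moves past the permutation
    matrix to a Borel factor on the right, which does not change the coset.\<close>
  have S: "S = (\<lambda>u. cosetB n (u * ?w)) ` ?U"
  proof
    show "(\<lambda>u. cosetB n (u * ?w)) ` ?U \<subseteq> S" using UB by (auto simp: S_def)
    show "S \<subseteq> (\<lambda>u. cosetB n (u * ?w)) ` ?U"
    proof
      fix x assume "x \<in> S"
      then obtain b where b: "b \<in> Borel n" "x = cosetB n (b * ?w)" by (auto simp: S_def)
      obtain u d where ud: "u \<in> carrier_mat n n" "\<And>i. i < n \<Longrightarrow> u $$ (i,i) = 1"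
        "\<And>i j. i < n \<Longrightarrow> j < i \<Longrightarrow> u $$ (i,j) = 0" "d \<in> monomial_mats n id" "b = u * d"
        using Borel_unipotent_torus[OF b(1)] by blast
      have cd: "d \<in> carrier_mat n n" using ud(4) by (intro SL_carrier monomial_SL)
      have "(d * ?w) $$ (i,j) = 0" if ij: "i < n" "j < n" "Suc i \<noteq> w (Suc j)" for i j
      proof -
        have "d $$ (i,k) * ?w $$ (k,j) = 0" if "k < n" for k
          using monomial_zero[OF ud(4) ij(1) that] monomial_zero[OF wM that ij(2)] ij
          by (cases "i = k") auto
        then show ?thesis using ij by (intro mult_mat_entry_zero[OF cd wc])
      qed
      then have "d * ?w \<in> monomial_mats n w"
        using SL_mult[OF monomial_SL[OF ud(4)] wSL] by (auto simp: monomial_mats_def)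
      then obtain e where e: "e \<in> Borel n" "d * ?w = ?w * e"
        using monomial_mats_torus[OF _ wM w] by blast
      have "b * ?w = u * (d * ?w)" unfolding ud(5) using ud(1) cd wc by (rule assoc_mult_mat)
      also have "\<dots> = u * ?w * e" unfolding e(2)
        using ud(1) wc Borel_carrier[OF e(1)] by (rule assoc_mult_mat[symmetric])
      finally have "x = cosetB n (u * ?w)"
        using b(2) cosetB_mult[of "u * ?w" n e] ud(1) wc e(1) by auto
      then show "x \<in> (\<lambda>u. cosetB n (u * ?w)) ` ?U" using ud by blast
    qed
  qed
  have one: "1\<^sub>m n \<in> ?U" by auto
  have uw: "u * ?w \<in> SL n" if "u \<in> ?U" for u
    using UB that wSL by (blast intro: SL_mult Borel_SL)
  have "irreducible_in (flag_top n) S"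
    unfolding irreducible_in_def
  proof (intro conjI allI impI)
    show "S \<noteq> {}" unfolding S using one by blast
    show "S \<subseteq> topspace (flag_top n)"
      unfolding S topspace_flag_top flags_def using uw by blast
    fix A B assume A: "closedin (flag_top n) A" and B: "closedin (flag_top n) B" and sub: "S \<subseteq> A \<union> B"
    obtain F where F: "F \<subseteq> poly_fun n" "{g \<in> SL n. cosetB n g \<in> A} = {g \<in> SL n. \<forall>f\<in>F. f g = 0}"
      using A unfolding closedin_flag_top by blast
    obtain G where G: "G \<subseteq> poly_fun n" "{g \<in> SL n. cosetB n g \<in> B} = {g \<in> SL n. \<forall>f\<in>G. f g = 0}"
      using B unfolding closedin_flag_top by blast
    show "S \<subseteq> A \<or> S \<subseteq> B"
    proof (rule ccontr)
      assume "\<not> ?thesis"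
      then obtain u v where u: "u \<in> ?U" "cosetB n (u * ?w) \<notin> A" and v: "v \<in> ?U" "cosetB n (v * ?w) \<notin> B"
        unfolding S by blast
      obtain f where f: "f \<in> F" "f (u * ?w) \<noteq> 0" using u uw F(2) by blast
      obtain g where g: "g \<in> G" "g (v * ?w) \<noteq> 0" using v uw G(2) by blast
      \<comment> \<open>The line through u and v stays unitriangular. On it f and g become
        polynomials in t, nonzero at t = 0 and t = 1 respectively, whose product vanishes
        identically.\<close>
      define \<gamma> where "\<gamma> t = mat n n (\<lambda>(i,j). u $$ (i,j) + t * (v $$ (i,j) - u $$ (i,j)))" for t
      have U\<gamma>: "\<gamma> t \<in> ?U" for t using u v by (auto simp: \<gamma>_def)
      have \<gamma>01: "\<gamma> 0 = u" "\<gamma> 1 = v" using u v by (auto simp: \<gamma>_def intro!: eq_matI)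
      have entries: "\<exists>p. \<forall>t. (\<gamma> t * ?w) $$ (i,j) = poly p t" if ij: "i < n" "j < n" for i j
      proof (intro exI allI)
        fix t
        have "(\<gamma> t * ?w) $$ (i,j) = (\<Sum>k<n. \<gamma> t $$ (i,k) * ?w $$ (k,j))"
          using ij wc by (intro mult_mat_entry) (auto simp: \<gamma>_def)
        also have "\<dots> = poly (\<Sum>k<n. [:u $$ (i,k), v $$ (i,k) - u $$ (i,k):] * [:?w $$ (k,j):]) t"
          unfolding poly_sum using ij by (intro sum.cong) (auto simp: \<gamma>_def algebra_simps)
        finally show "(\<gamma> t * ?w) $$ (i,j) =
          poly (\<Sum>k<n. [:u $$ (i,k), v $$ (i,k) - u $$ (i,k):] * [:?w $$ (k,j):]) t" .
      qed
      obtain p where p: "\<And>t. f (\<gamma> t * ?w) = poly p t"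
        using poly_fun_curve[of f n "\<lambda>t. \<gamma> t * ?w"] f(1) F(1) entries by blast
      obtain q where q: "\<And>t. g (\<gamma> t * ?w) = poly q t"
        using poly_fun_curve[of g n "\<lambda>t. \<gamma> t * ?w"] g(1) G(1) entries by blast
      have "poly (p * q) t = 0" for t
      proof -
        have "cosetB n (\<gamma> t * ?w) \<in> A \<union> B" using sub U\<gamma>[of t] unfolding S by blast
        then have "f (\<gamma> t * ?w) = 0 \<or> g (\<gamma> t * ?w) = 0"
          using uw[OF U\<gamma>[of t]] F(2) G(2) f(1) g(1) by blast
        then show ?thesis using p q by auto
      qed
      then have "p * q = 0" using poly_all_0_iff_0[of "p * q"] by blast
      moreover have "p \<noteq> 0" using p[of 0] f(2) \<gamma>01 by auto
      moreover have "q \<noteq> 0" using q[of 1] g(2) \<gamma>01 by auto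
      ultimately show False by simp
    qed
  qed
  then show "irreducible_in (flag_top n) {cosetB n (b * ?w) | b. b \<in> Borel n}" by (simp add: S_def)
qed

section \<open>The Hessenberg variety of the highest root vector\<close>

lemma conj_e_theta_entry:
  assumes g: "g \<in> SL n" and ij: "i < n" "j < n"
  shows "(ginv n g * e_theta n * g) $$ (i,j) = ginv n g $$ (i,0) * g $$ (n - 1,j)"
proof -
  have n: "n > 0" using ij by simp
  note c = SL_carrier[OF g] SL_carrier[OF ginv_SL[OF g]]
  have e: "e_theta n \<in> carrier_mat n n" by (simp add: e_theta_def)
  have ge: "(ginv n g * e_theta n) $$ (i,k) = (if k = n - 1 then ginv n g $$ (i,0) else 0)" if "k < n" for k
  proof -
    have "(ginv n g * e_theta n) $$ (i,k) = (\<Sum>l<n. ginv n g $$ (i,l) * e_theta n $$ (l,k))"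
      using c e ij that by (intro mult_mat_entry)
    also have "\<dots> = (\<Sum>l<n. if l = 0 then (if k = n - 1 then ginv n g $$ (i,0) else 0) else 0)"
      using that by (intro sum.cong) (auto simp: e_theta_def)
    finally show ?thesis using n by simp
  qed
  have "(ginv n g * e_theta n * g) $$ (i,j) = (\<Sum>k<n. (ginv n g * e_theta n) $$ (i,k) * g $$ (k,j))"
    using c e ij by (intro mult_mat_entry) auto
  also have "\<dots> = (\<Sum>k<n. if k = n - 1 then ginv n g $$ (i,0) * g $$ (n - 1,j) else 0)"
    using ge by (intro sum.cong) auto
  finally show ?thesis using n by simp
qed

text \<open>This is entry (n - 1, 0) of g times its inverse, off the diagonal since n \<ge> 2. It
  yields both the trace condition of the Hessenberg space and the distinctness of the two extreme
  positions.\<close>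

lemma hess_pairing_zero:
  assumes g: "g \<in> SL n" and n: "n \<ge> 2"
  shows "(\<Sum>i<n. ginv n g $$ (i,0) * g $$ (n - 1,i)) = 0"
proof -
  have "(g * ginv n g) $$ (n - 1,0) = (\<Sum>i<n. g $$ (n - 1,i) * ginv n g $$ (i,0))"
    using n by (intro mult_mat_entry SL_carrier[OF g] SL_carrier[OF ginv_SL[OF g]]) auto
  then show ?thesis using n by (simp add: ginv_right[OF g] mult.commute)
qed

lemma in_hess_space_iff:
  assumes g: "g \<in> SL n" and n: "n \<ge> 2"
  shows "in_hess_space n h (ginv n g * e_theta n * g) \<longleftrightarrow>
    (\<forall>i<n. \<forall>j<n. h (j + 1) < i + 1 \<longrightarrow> ginv n g $$ (i,0) * g $$ (n - 1,j) = 0)"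
proof -
  have "ginv n g * e_theta n * g \<in> carrier_mat n n"
    using SL_carrier[OF g] SL_carrier[OF ginv_SL[OF g]]
    by (auto intro!: mult_carrier_mat simp: e_theta_def)
  then show ?thesis
    using conj_e_theta_entry[OF g] hess_pairing_zero[OF g n] by (simp add: in_hess_space_def)
qed

lemma hess_space_iff_corner:
  assumes g: "g \<in> SL n" and n: "n \<ge> 2" and h: "hessenberg_fun n h"
  shows "in_hess_space n h (ginv n g * e_theta n * g) \<longleftrightarrow>
    (\<exists>(i,j)\<in>corners n h. g \<in> hess_piece n i j)"
proof
  let ?x = "\<lambda>i. ginv n g $$ (i,0)" and ?y = "\<lambda>j. g $$ (n - 1,j)"
  note c = SL_carrier[OF g] SL_carrier[OF ginv_SL[OF g]]
  assume "in_hess_space n h (ginv n g * e_theta n * g)"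
  then have H: "\<And>i j. i < n \<Longrightarrow> j < n \<Longrightarrow> h (j + 1) < i + 1 \<Longrightarrow> ?x i * ?y j = 0"
    using in_hess_space_iff[OF g n] by blast
  have "\<exists>i<n. ?x i \<noteq> 0"
  proof (rule ccontr)
    assume "\<not> ?thesis"
    moreover have "(g * ginv n g) $$ (0,0) = (\<Sum>k<n. g $$ (0,k) * ?x k)"
      using n c by (intro mult_mat_entry) auto
    ultimately show False using n by (simp add: ginv_right[OF g])
  qed
  then have ne: "{i. i < n \<and> ?x i \<noteq> 0} \<noteq> {}" by auto
  have fin: "finite {i. i < n \<and> ?x i \<noteq> 0}" by auto
  define a where "a = Max {i. i < n \<and> ?x i \<noteq> 0}"
  have a: "a < n" "?x a \<noteq> 0" using Max_in[OF fin ne] unfolding a_def by auto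
  have amax: "?x i = 0" if "i < n" "a < i" for i
    using Max_ge[OF fin, of i, folded a_def] that by auto
  have "\<exists>j. j < n \<and> ?y j \<noteq> 0"
  proof (rule ccontr)
    assume "\<not> ?thesis"
    moreover have "(g * ginv n g) $$ (n - 1,n - 1) = (\<Sum>k<n. ?y k * ginv n g $$ (k,n - 1))"
      using n c by (intro mult_mat_entry) auto
    ultimately show False using n by (simp add: ginv_right[OF g])
  qed
  then obtain b where b: "b < n" "?y b \<noteq> 0" and bmin: "\<And>j. j < b \<Longrightarrow> \<not> (j < n \<and> ?y j \<noteq> 0)"
    using exists_least_iff[of "\<lambda>j. j < n \<and> ?y j \<noteq> 0"] by auto
  \<comment> \<open>If the two positions agreed, the pairing would reduce to one nonzero term: x
    vanishes after \<open>a\<close> and y before \<open>b\<close>. Both indices start at 0, hence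
    the successors when corners are consulted.\<close>
  have "a \<noteq> b"
  proof
    assume "a = b"
    then have "(\<Sum>i<n. ?x i * ?y i) = (\<Sum>i<n. if i = a then ?x a * ?y a else 0)"
      using amax bmin by (intro sum.cong) (auto simp: nat_neq_iff)
    then have "?x a * ?y a = 0" using hess_pairing_zero[OF g n] a by simp
    then show False using a b \<open>a = b\<close> by simp
  qed
  moreover have "Suc a \<le> h (Suc b)" using H[of a b] a b by force
  ultimately obtain i j where ij: "(i,j) \<in> corners n h" "Suc a \<le> i" "j \<le> Suc b"
    using corner_dominating[OF h, of "Suc b" "Suc a"] b by auto
  have "g \<in> hess_piece n i j"
    using g amax bmin ij(2,3) by (auto simp: hess_piece_def)
  then show "\<exists>(i,j)\<in>corners n h. g \<in> hess_piece n i j" using ij(1) by auto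
next
  assume "\<exists>(i,j)\<in>corners n h. g \<in> hess_piece n i j"
  then obtain i j where ij: "(i,j) \<in> corners n h" "g \<in> hess_piece n i j" by auto
  have j: "j \<in> {1..n}" "i \<le> h j" using ij(1) hbar_le[of j h] by (auto simp: corners_def)
  have "ginv n g $$ (k,0) * g $$ (n - 1,l) = 0" if kl: "k < n" "l < n" "h (l + 1) < k + 1" for k l
  proof (cases "Suc l < j")
    case True
    then show ?thesis using ij(2) kl by (auto simp: hess_piece_def)
  next
    case False
    \<comment> \<open>Column l lies weakly right of the corner, so i \<le> h j \<le> h (l + 1) \<le>
      k and the factor from the inverse vanishes.\<close>
    then have "h j \<le> h (l + 1)" using h j kl by (auto simp: hessenberg_fun_def)
    then have "i \<le> k" using j kl by simp
    then show ?thesis using ij(2) kl by (auto simp: hess_piece_def)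
  qed
  then show "in_hess_space n h (ginv n g * e_theta n * g)" using in_hess_space_iff[OF g n] by blast
qed

lemma hess_var_eq_Union:
  assumes n: "n \<ge> 2" and h: "hessenberg_fun n h"
  shows "hess_var n h = (\<Union>(i,j)\<in>corners n h. cosetB n ` hess_piece n i j)"
proof -
  have "hess_var n h = cosetB n ` {g \<in> SL n. \<exists>(i,j)\<in>corners n h. g \<in> hess_piece n i j}"
    unfolding hess_var_def using hess_space_iff_corner[OF _ n h] by blast
  also have "\<dots> = (\<Union>(i,j)\<in>corners n h. cosetB n ` hess_piece n i j)"
    by (auto simp: hess_piece_def)
  finally show ?thesis .
qed

theorem mainTheorem15:
  fixes n :: nat and h :: "nat \<Rightarrow> nat"
  assumes "n \<ge> 2" and "hessenberg_fun n h"
  shows "bij_betw (\<lambda>(i,j). schubert n (longest_perm n i j))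
           (corners n h)
           (irreducible_components (subtopology (flag_top n) (hess_var n h)))"
proof (rule irreducible_components_finite_Union)
  let ?C = "\<lambda>(i,j). schubert n (longest_perm n i j)"
  let ?T = "subtopology (flag_top n) (hess_var n h)"
  have n: "n > 0" using assms(1) by simp
  have corner: "i \<in> {1..n}" "j \<in> {1..n}" "i \<noteq> j" if "(i,j) \<in> corners n h" for i j
    using that corner_off_diagonal[OF assms(2) that] by (auto simp: corners_def)
  have longest: "decreasing_off n i j (longest_perm n i j)" if "(i,j) \<in> corners n h" for i j
    using longest_perm_decreasing_off corner[OF that] by blast
  have C: "?C x = cosetB n ` hess_piece n (fst x) (snd x)" if "x \<in> corners n h" for x
    using that schubert_eq_hess_piece[OF corner longest] by (cases x) auto
  have var: "hess_var n h = (\<Union>x\<in>corners n h. ?C x)"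
    unfolding hess_var_eq_Union[OF assms] using C by (intro SUP_cong) auto
  have sub: "?C x \<subseteq> hess_var n h" if "x \<in> corners n h" for x
    using that var by blast
  show "finite (corners n h)" by (rule finite_corners)
  show "closedin ?T (?C x)" if "x \<in> corners n h" for x
    using sub[OF that] closedin_hess_piece[OF n] C[OF that] by (simp add: closedin_subset_topspace)
  show "irreducible_in ?T (?C x)" if "x \<in> corners n h" for x
  proof (rule irreducible_in_subtopology)
    obtain i j where x: "x = (i,j)" by force
    then have "longest_perm n i j permutes {1..n}"
      using longest[of i j] that by (simp add: decreasing_off_def)
    then show "irreducible_in (flag_top n) (?C x)" unfolding x using irreducible_schubert n by simp
  qed (rule sub[OF that])
  have "hess_var n h \<subseteq> flags n" by (auto simp: hess_var_def flags_def)
  then show "topspace ?T = (\<Union>x\<in>corners n h. ?C x)"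
    using var by (auto simp: topspace_flag_top)
  show "x = y" if x: "x \<in> corners n h" and y: "y \<in> corners n h" and le: "?C x \<subseteq> ?C y" for x y
  proof -
    obtain i j k l where xy: "x = (i,j)" "y = (k,l)" by fastforce
    \<comment> \<open>The permutation flag of \<open>w\<close> tests the inclusion: it lies in the
      piece of (k,l) only if the positions i of 1 and j of n satisfy i \<le> k and l \<le>
      j.\<close>
    define w where "w = longest_perm n i j"
    have w: "w permutes {1..n}" "w i = 1" "w j = n"
      using longest[of i j] x xy by (auto simp: decreasing_off_def w_def)
    note wM = perm_rep_monomial[OF w(1) n]
    have "perm_rep n w \<in> hess_piece n i j"
      using monomial_in_hess_piece[OF wM w(1) n w(2,3)] by simp
    then have "cosetB n (perm_rep n w) \<in> cosetB n ` hess_piece n k l"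
      using le C[OF x] C[OF y] xy by auto
    then have "perm_rep n w \<in> hess_piece n k l"
      using cosetB_in_hess_piece_iff[OF monomial_SL[OF wM]] by blast
    then have "i \<le> k" "l \<le> j" using monomial_in_hess_piece[OF wM w(1) n w(2,3)] by auto
    then show "x = y" using corners_antichain[OF assms(2)] x y xy by blast
  qed
qed

end
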